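(* Let $n\ge1$ and $p$ be integers, let $1\le s\le S<\frac p2$ be integers, and let $X_1,\dots,X_n$ be i.i.d. centered Gaussian vectors in $\mathbb{R}^p$ with $\Sigma_n=\frac1n\sum_{k=1}^nX_kX_k^T$. For $u>1$ let $$t_{n,p}^{HS}=s\max\left\{\sqrt{\frac{4u\log\left(s\binom{S}{s}\right)}{n(p-S)}},\;\frac{8u\log\left(s\binom{S}{s}\right)}{n(p-S)}\right\}$$ and define the test $$\Delta_n^{HS}=\max_{\mathbf{S}\subseteq\{1,\dots,S\},\ \#\mathbf{S}=s} I\left(\sum_{j\in\mathbf{S}}\left|\varphi_{A_j}(\Sigma_n-I_p)\right|\ge t_{n,p}^{HS}\right).$$ Then $$R(\Delta_n^{HS},\mathcal{F})\le 4\exp\left[-(u-1)\log\left(s\binom{S}{s}\right)\right],\qquad \mathcal{F}=\mathcal{F}(s,S,\sigma),$$ provided that $$\sigma\ge t_{n,p}^{HS}+\max\left\{\sqrt{\frac{4(u-1)\log\left(s(2s+1)\binom{S}{s}\right)}{n(p-S)}},\;\frac{8(u-1)\log\left(s(2s+1)\binom{S}{s}\right)}{n(p-S)}\right\}.$$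
   Context: $I(\cdot)$ is the indicator function. $\mathbb{P}_\Sigma$ denotes probability when $X_1,\dots,X_n$ are i.i.d. $\mathcal{N}_p(0,\Sigma)$. For a symmetric $p\times p$ matrix $A$, $\varphi_A(B)=\mathrm{Tr}(AB)$. For $1\le j\le p-1$, $A_j$ is the $p\times p$ matrix with entries $[A_j]_{k\ell}=\frac{1}{2(p-j)}$ if $|k-\ell|=j$ and $0$ otherwise. $\mathcal{S}_p^{++}$ is the set of symmetric positive definite $p\times p$ matrices and $\mathcal{T}_p$ the set of $p\times p$ Toeplitz matrices; for $\Sigma\in\mathcal{S}_p^{++}\cap\mathcal{T}_p$ write $\Sigma_{ij}=\sigma_{|i-j|}$. Standing assumption: all covariance matrices satisfy $\sigma_0=1$ (correlation matrices). For a real $\sigma>0$, $\mathcal{F}(s,S,\sigma)$ is the set of $\Sigma\in\mathcal{S}_p^{++}\cap\mathcal{T}_p$ (with $\sigma_0=1$) for which there exists $\mathbf{S}\subseteq\{1,\dots,S\}$ with $|\mathbf{S}|=s$ such that $|\sigma_j|\ge\sigma$ for all $j\in\mathbf{S}$ and $\sigma_j=0$ for all $j\in\{1,\dots,p-1\}\setminus\mathbf{S}$. For a test $\Delta_n$ (a $\{0,1\}$-valued function of the observations) and a class $\mathcal{G}$ of covariance matrices, the maximal testing risk is $R(\Delta_n,\mathcal{G})=\mathbb{P}_{I_p}(\Delta_n=1)+\sup_{\Sigma\in\mathcal{G}}\mathbb{P}_\Sigma(\Delta_n=0)$ (a supremum over an empty class being $0$). *)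

theory Defs
  imports "HOL-Probability.Probability"
begin

text \<open>
  The dimension is \<open>p = CARD('p)\<close>. The linear order on the index type only serves to number the
  coordinates: \<open>pos i\<close> is the position of \<open>i\<close>, counted from 0. Only differences of positions
  matter below, so that counting from 0 instead of 1 is immaterial.
\<close>

definition pos :: "'p::{finite,linorder} \<Rightarrow> nat" where
  "pos i = card {j. j < i}"

lemma bij_betw_pos: "bij_betw pos (UNIV :: 'p::{finite,linorder} set) {..<CARD('p)}"
proof -
  have less: "pos i < pos j" if "i < j" for i j :: 'p
    unfolding pos_def using that by (intro psubset_card_mono) auto
  have inj: "inj (pos :: 'p \<Rightarrow> nat)"
    by (rule injI) (metis less linorder_neqE order_less_irrefl)
  have "pos i < CARD('p)" for i :: 'p
    unfolding pos_def by (intro psubset_card_mono) auto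
  then have "range (pos :: 'p \<Rightarrow> nat) \<subseteq> {..<CARD('p)}"
    by auto
  moreover have "card (range (pos :: 'p \<Rightarrow> nat)) = card {..<CARD('p)}"
    using inj by (simp add: card_image)
  ultimately have "range (pos :: 'p \<Rightarrow> nat) = {..<CARD('p)}"
    by (intro card_subset_eq) auto
  with inj show ?thesis
    by (simp add: bij_betw_def)
qed

definition lag :: "'p::{finite,linorder} \<Rightarrow> 'p \<Rightarrow> nat" where
  "lag k l = nat \<bar>int (pos k) - int (pos l)\<bar>"

definition sym_pos_def :: "(real^'p^'p) set" where
  "sym_pos_def = {M. transpose M = M \<and> (\<forall>x. x \<noteq> 0 \<longrightarrow> 0 < x \<bullet> (M *v x))}"

definition toeplitz :: "(real^'p::{finite,linorder}^'p::{finite,linorder}) set" where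
  "toeplitz = {M. \<exists>d :: int \<Rightarrow> real. \<forall>k l. M $ k $ l = d (int (pos k) - int (pos l))}"

text \<open>
  The sequence \<open>c\<close> below is \<open>(\<sigma>\<^sub>0, \<sigma>\<^sub>1, \<dots>)\<close>; its values up to \<open>p - 1\<close> are determined by the matrix.
\<close>

definition sparse_class :: "nat \<Rightarrow> nat \<Rightarrow> real \<Rightarrow> (real^'p::{finite,linorder}^'p::{finite,linorder}) set" where
  "sparse_class s S \<sigma> =
     {M \<in> sym_pos_def \<inter> toeplitz.
        \<exists>c :: nat \<Rightarrow> real. (\<forall>k l. M $ k $ l = c (lag k l)) \<and> c 0 = 1 \<and>
          (\<exists>T \<subseteq> {1..S}. card T = s \<and>
             (\<forall>j\<in>T. \<bar>c j\<bar> \<ge> \<sigma>) \<and> (\<forall>j \<in> {1..CARD('p) - 1} - T. c j = 0))}"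

definition A_mat :: "nat \<Rightarrow> real^'p::{finite,linorder}^'p::{finite,linorder}" where
  "A_mat j = (\<chi> k l. if lag k l = j then 1 / (2 * (real CARD('p) - real j)) else 0)"

definition phi :: "real^'p^'p \<Rightarrow> real^'p^'p \<Rightarrow> real" where
  "phi A B = trace (A ** B)"

text \<open>The law \<open>N(0, M)\<close>, given by its Lebesgue density; only used for \<open>M \<in> sym_pos_def\<close>.\<close>

definition gaussian :: "real^'p^'p \<Rightarrow> (real^'p) measure" where
  "gaussian M = density lborel (\<lambda>x. ennreal
     (exp (- (x \<bullet> (matrix_inv M *v x)) / 2) / sqrt ((2 * pi) ^ CARD('p) * det M)))"

definition iid_gaussian :: "nat \<Rightarrow> real^'p^'p \<Rightarrow> (nat \<Rightarrow> real^'p) measure" where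
  "iid_gaussian n M = (\<Pi>\<^sub>M k\<in>{1..n}. gaussian M)"

definition sample_cov :: "nat \<Rightarrow> (nat \<Rightarrow> real^'p) \<Rightarrow> real^'p^'p" where
  "sample_cov n X = (1 / real n) *\<^sub>R (\<Sum>k=1..n. (columnvector (X k) :: real^1^'p) ** rowvector (X k))"

lemma sample_cov_nth: "sample_cov n X $ i $ j = (\<Sum>k=1..n. X k $ i * X k $ j) / real n"
  by (simp add: sample_cov_def matrix_matrix_mult_def columnvector_def rowvector_def)

definition threshold_HS :: "nat \<Rightarrow> nat \<Rightarrow> nat \<Rightarrow> nat \<Rightarrow> real \<Rightarrow> real" where
  "threshold_HS n p s S u = real s *
     max (sqrt (4 * u * ln (real (s * (S choose s))) / (real n * (real p - real S))))
         (8 * u * ln (real (s * (S choose s))) / (real n * (real p - real S)))"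

definition test_HS ::
  "nat \<Rightarrow> nat \<Rightarrow> nat \<Rightarrow> real \<Rightarrow> (nat \<Rightarrow> real^'p::{finite,linorder}) \<Rightarrow> nat" where
  "test_HS n s S u X =
     (MAX T \<in> {T. T \<subseteq> {1..S} \<and> card T = s}.
        of_bool ((\<Sum>j\<in>T. \<bar>phi (A_mat j) (sample_cov n X - mat 1)\<bar>) \<ge> threshold_HS n CARD('p) s S u))"

text \<open>The supremum over the empty class is 0 by convention; \<open>Sup {}\<close> is unspecified on the reals.\<close>

definition max_risk ::
  "nat \<Rightarrow> ((nat \<Rightarrow> real^'p) \<Rightarrow> nat) \<Rightarrow> (real^'p^'p) set \<Rightarrow> real" where
  "max_risk n \<Delta> G =
     \<P>(X in iid_gaussian n (mat 1). \<Delta> X = 1) +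
     (if G = {} then 0 else (SUP M\<in>G. \<P>(X in iid_gaussian n M. \<Delta> X = 0)))"

end

theory Submission
  imports Defs
begin

text \<open>
  Every statistic is a Gaussian quadratic form \<open>x \<bullet> (B *v x)\<close>. Diagonalizing \<open>\<Sigma>\<close> and \<open>B\<close>
  simultaneously, its Laplace transform at \<open>c\<close> is \<open>\<Prod>\<^sub>i (1 + 2 c \<mu>\<^sub>i)\<^bsup>-1/2\<^esup>\<close>, where the \<open>\<mu>\<^sub>i\<close> are the
  eigenvalues of \<open>B \<Sigma>\<close>, and Chernoff's bound gives tails in terms of \<open>\<Sum>\<^sub>i \<mu>\<^sub>i\<^sup>2\<close> and of the least \<open>\<mu>\<^sub>i\<close>.
  For the first kind error it is applied to each \<open>\<plusminus>A\<^sub>j\<close> with \<open>\<Sigma> = I\<close>, and a union bound over the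
  \<open>S \<le> s (S choose s)\<close> lags suffices. For the second kind error it is applied to \<open>B = \<Sum>\<^sub>j sgn(\<sigma>\<^sub>j) A\<^sub>j\<close>
  over the support of \<open>\<Sigma>\<close>, whose mean \<open>\<Sum>\<^sub>j \<bar>\<sigma>\<^sub>j\<bar>\<close> exceeds the threshold.
  If \<open>s \<ge> 2\<close>, bounds on the norm of \<open>\<Sigma>\<close> by row sums are enough, because \<open>2 b < p\<close> for the largest lag
  \<open>b\<close> of the support forces \<open>\<sigma>\<^sup>2 \<le> 1/2\<close>, so that the threshold is small. If \<open>s = 1\<close>, there is no room
  for such losses, but \<open>\<Sigma> = I + \<sigma>G\<close> commutes with \<open>B\<close>, the spectrum of \<open>G\<close> is symmetric, and
  positive definiteness gives \<open>\<bar>\<sigma> g\<bar> \<le> 1\<close> for all its eigenvalues \<open>g\<close>, which yields exactly the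
  required constants.
\<close>

section \<open>Diagonalization of symmetric matrices\<close>


text \<open>A maximizer \<open>v\<close> of the Rayleigh quotient on the unit sphere of
  \<open>V\<close> is an eigenvector: with \<open>c\<close> the maximum, the quadratic form
  \<open>g\<close> is nonnegative on \<open>V\<close> and vanishes at \<open>v\<close>, so its
  variation in the direction \<open>w = c *\<^sub>R v - f v\<close> cannot have a linear term, which
  forces \<open>w = 0\<close>.\<close>

lemma selfadjoint_eigenvector:
  fixes f :: "'a::euclidean_space \<Rightarrow> 'a"
  assumes lin: "linear f" and sa: "\<And>x y. f x \<bullet> y = x \<bullet> f y"
    and V: "subspace V" "f ` V \<subseteq> V" "V \<noteq> {0}"
  obtains v c where "v \<in> V" "norm v = 1" "f v = c *\<^sub>R v"
proof -
  define K where "K = sphere 0 1 \<inter> V"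
  have "compact K"
    unfolding K_def by (intro compact_Int_closed compact_sphere closed_subspace V)
  moreover have "K \<noteq> {}"
  proof -
    obtain x where "x \<in> V" "x \<noteq> 0" using V subspace_0 by blast
    then have "x /\<^sub>R norm x \<in> K"
      using V by (auto simp: K_def subspace_scale)
    then show ?thesis by blast
  qed
  moreover have "continuous_on K (\<lambda>x. x \<bullet> f x)"
    using lin by (intro continuous_on_inner continuous_on_id linear_continuous_on)
      (simp add: linear_conv_bounded_linear)
  ultimately obtain v where v: "v \<in> K" and max: "\<And>x. x \<in> K \<Longrightarrow> x \<bullet> f x \<le> v \<bullet> f v"
    using continuous_attains_sup by metis
  define c where "c = v \<bullet> f v"
  define g where "g x = c * (x \<bullet> x) - x \<bullet> f x" for x
  have vV: "v \<in> V" "v \<bullet> v = 1" using v by (auto simp: K_def norm_eq_1)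
  have g_nonneg: "g x \<ge> 0" if "x \<in> V" for x
  proof (cases "x = 0")
    case True then show ?thesis by (simp add: g_def)
  next
    case False
    then have "x /\<^sub>R norm x \<in> K"
      using V that by (auto simp: K_def subspace_scale)
    from max[OF this] have "x \<bullet> f x / (norm x)\<^sup>2 \<le> c"
      by (simp add: c_def linear_cmul[OF lin] power2_eq_square divide_inverse mult_ac)
    then show ?thesis
      using False by (simp add: g_def field_simps flip: power2_norm_eq_inner)
  qed
  define w where "w = c *\<^sub>R v - f v"
  have wV: "w \<in> V" unfolding w_def using V vV by (auto intro!: subspace_diff subspace_scale)
  have quad: "0 \<le> 2 * t * (w \<bullet> w) + t\<^sup>2 * g w" for t
  proof -
    have "v + t *\<^sub>R w \<in> V" using V vV wV by (auto intro!: subspace_add subspace_scale)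
    from g_nonneg[OF this] have "0 \<le> g (v + t *\<^sub>R w)" .
    also have "g (v + t *\<^sub>R w) = g v + 2 * t * ((c *\<^sub>R v - f v) \<bullet> w) + t\<^sup>2 * g w"
    proof -
      have "w \<bullet> f v = v \<bullet> f w" by (metis sa inner_commute)
      then show ?thesis
        by (simp add: g_def linear_add[OF lin] linear_cmul[OF lin] inner_add_left inner_add_right
            inner_diff_left algebra_simps power2_eq_square sa inner_commute[of w v])
    qed
    also have "g v = 0" using vV by (simp add: g_def c_def)
    finally show ?thesis by (simp add: w_def)
  qed
  have "w = 0"
  proof (rule ccontr)
    assume "w \<noteq> 0"
    then have pos: "w \<bullet> w > 0" by simp
    \<comment> \<open>A step small enough for the linear term to beat the quadratic one; the summand
      1 keeps the denominator positive when \<open>g w = 0\<close>.\<close>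
    define t where "t = - (w \<bullet> w) / (g w + 1)"
    have gp: "g w \<ge> 0" using g_nonneg wV by simp
    have "2 * t * (w \<bullet> w) + t\<^sup>2 * g w = - (w \<bullet> w)\<^sup>2 * (g w + 2) / (g w + 1)\<^sup>2"
      using gp unfolding t_def by (simp add: divide_simps power2_eq_square) algebra
    also have "\<dots> < 0" using pos gp by (simp add: divide_neg_pos mult_pos_pos zero_less_power2)
    finally show False using quad[of t] by simp
  qed
  then have "f v = c *\<^sub>R v" by (simp add: w_def)
  with v show ?thesis using that by (auto simp: K_def)
qed

text \<open>Induction on the dimension: a unit eigenvector is split off, and self-adjointness keeps
  its orthogonal complement in \<open>V\<close> invariant.\<close>

lemma selfadjoint_orthonormal_eigenbasis:
  fixes f :: "'a::euclidean_space \<Rightarrow> 'a"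
  assumes lin: "linear f" and sa: "\<And>x y. f x \<bullet> y = x \<bullet> f y"
  shows "subspace V \<Longrightarrow> f ` V \<subseteq> V \<Longrightarrow>
    \<exists>B \<subseteq> V. pairwise orthogonal B \<and> (\<forall>v\<in>B. norm v = 1 \<and> (\<exists>c. f v = c *\<^sub>R v)) \<and> span B = V"
proof (induction "dim V" arbitrary: V rule: less_induct)
  case less
  show ?case
  proof (cases "V = {0}")
    case True
    then show ?thesis by (intro exI[of _ "{}"]) auto
  next
    case False
    obtain v c where v: "v \<in> V" "norm v = 1" "f v = c *\<^sub>R v"
      using selfadjoint_eigenvector[OF lin sa less.prems False] by blast
    have vv: "v \<bullet> v = 1" using v by (simp add: norm_eq_1)
    define W where "W = {w \<in> V. v \<bullet> w = 0}"
    have W: "subspace W"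
      using less.prems(1) by (auto simp: W_def subspace_def inner_add_right)
    have fW: "f ` W \<subseteq> W"
    proof
      fix y assume "y \<in> f ` W"
      then obtain w where w: "w \<in> W" "y = f w" by blast
      have "v \<bullet> f w = f v \<bullet> w" by (simp add: sa)
      then show "y \<in> W" using w less.prems(2) by (auto simp: W_def v)
    qed
    have "v \<notin> W" by (simp add: W_def vv)
    moreover have "W \<subseteq> V" by (auto simp: W_def)
    ultimately have "W \<subset> V" using v(1) by blast
    then have "dim W < dim V"
      using W less.prems(1) by (metis dim_psubset span_eq_iff)
    from less.hyps[OF this W fW] obtain B where B: "B \<subseteq> W" "pairwise orthogonal B"
      "\<forall>v\<in>B. norm v = 1 \<and> (\<exists>c. f v = c *\<^sub>R v)" "span B = W" by blast
    have "V \<subseteq> span (insert v B)"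
    proof
      fix x assume x: "x \<in> V"
      have "x - (v \<bullet> x) *\<^sub>R v \<in> W"
        using x v less.prems(1) by (auto simp: W_def inner_diff_right vv intro!: subspace_diff subspace_scale)
      then show "x \<in> span (insert v B)"
        using B(4) by (auto simp: span_insert)
    qed
    moreover have "span (insert v B) \<subseteq> V"
      using B(1) v less.prems(1) by (intro span_minimal) (auto simp: W_def)
    moreover have "pairwise orthogonal (insert v B)"
      using B(1,2) by (auto simp: pairwise_insert orthogonal_def W_def inner_commute)
    ultimately show ?thesis
      using B(1,3) v by (intro exI[of _ "insert v B"]) (auto simp: W_def)
  qed
qed

definition diag_mat :: "('n \<Rightarrow> real) \<Rightarrow> real^'n^'n" where
  "diag_mat d = (\<chi> i j. if i = j then d i else 0)"

lemma diag_mat_nth [simp]: "diag_mat d $ i $ j = (if i = j then d i else 0)"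
  by (simp add: diag_mat_def)

lemma diag_mat_mult: "diag_mat d ** diag_mat e = diag_mat (\<lambda>i. d i * e i)"
  by (simp add: vec_eq_iff matrix_matrix_mult_def if_distrib[of "\<lambda>x. x * _"] cong: if_cong)

lemma transpose_diag_mat [simp]: "transpose (diag_mat d) = diag_mat d"
  by (auto simp: vec_eq_iff transpose_def)

lemma trace_diag_mat [simp]: "trace (diag_mat d) = sum d UNIV"
  by (simp add: trace_def)

lemma det_diag_mat [simp]: "det (diag_mat d) = prod d UNIV"
  by (subst det_diagonal) auto

lemma symmetric_matrix_diagonalization:
  fixes C :: "real^'n^'n"
  assumes "transpose C = C"
  obtains U d where "orthogonal_matrix U" "transpose U ** C ** U = diag_mat d"
proof -
  have sa: "(C *v x) \<bullet> y = x \<bullet> (C *v y)" for x y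
    by (metis assms dot_lmul_matrix inner_commute transpose_matrix_vector)
  obtain B where B: "pairwise orthogonal B" "\<forall>v\<in>B. norm v = 1 \<and> (\<exists>c. C *v v = c *\<^sub>R v)" "span B = UNIV"
    using selfadjoint_orthonormal_eigenbasis[OF matrix_vector_mul_linear sa, of UNIV] by auto
  have ind: "independent B"
    using B by (intro pairwise_orthogonal_independent) auto
  then have fin: "finite B" by (rule independent_imp_finite)
  have "card B = CARD('n)"
    using dim_span_eq_card_independent[OF ind] B(3) by simp
  \<comment> \<open>The eigenbasis is numbered by the index type; its members become the columns of
    \<open>U\<close>.\<close>
  then obtain h :: "'n \<Rightarrow> real^'n" where h: "bij_betw h UNIV B"
    using fin by (metis finite_same_card_bij finite_class.finite_UNIV)
  then have hB: "h i \<in> B" for i by (auto simp: bij_betw_def)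
  have orth: "h i \<bullet> h j = (if i = j then 1 else 0)" for i j
  proof (cases "i = j")
    case True then show ?thesis using B(2) hB by (simp add: norm_eq_1)
  next
    case False
    then have "h i \<noteq> h j" using h by (auto simp: bij_betw_def inj_on_def)
    then show ?thesis using False B(1) hB by (auto simp: pairwise_def orthogonal_def)
  qed
  have "\<forall>i. \<exists>c. C *v h i = c *\<^sub>R h i"
    using B(2) hB by blast
  then obtain d where d: "\<And>i. C *v h i = d i *\<^sub>R h i"
    using choice[of "\<lambda>i c. C *v h i = c *\<^sub>R h i"] by blast
  define U where "U = (\<chi> i j. h j $ i)"
  have Uu: "(transpose U ** A ** U) $ i $ j = h i \<bullet> (A *v h j)" for A i j
  proof -
    have "(A ** U) $ k $ j = (A *v h j) $ k" for k
      by (simp add: U_def matrix_matrix_mult_def matrix_vector_mult_def)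
    moreover have "(transpose U ** (A ** U)) $ i $ j = (\<Sum>k\<in>UNIV. h i $ k * (A ** U) $ k $ j)"
      unfolding matrix_matrix_mult_def[of "transpose U"] by (simp add: U_def transpose_def)
    ultimately show ?thesis
      by (simp add: matrix_mul_assoc[symmetric] inner_vec_def)
  qed
  show ?thesis
  proof
    show "orthogonal_matrix U"
      using Uu[of "mat 1", unfolded matrix_mul_rid matrix_vector_mul_lid]
      unfolding orthogonal_matrix by (simp add: vec_eq_iff orth mat_def)
    show "transpose U ** C ** U = diag_mat d"
      by (simp add: vec_eq_iff Uu d orth)
  qed
qed

section \<open>Gaussian integrals\<close>


lemma nn_integral_lborel_shift:
  fixes c :: "'a::euclidean_space"
  assumes [measurable]: "h \<in> borel_measurable borel"
  shows "(\<integral>\<^sup>+x. h (c + x) \<partial>lborel) = (\<integral>\<^sup>+x. h x \<partial>lborel)"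
proof -
  have "(\<integral>\<^sup>+x. h x \<partial>lborel) = (\<integral>\<^sup>+x. h x \<partial>distr lborel borel ((+) c))"
    by (simp add: lborel_distr_plus)
  then show ?thesis by (simp add: nn_integral_distr)
qed

lemma nn_integral_lborel_uminus:
  fixes h :: "'a::euclidean_space \<Rightarrow> ennreal"
  assumes [measurable]: "h \<in> borel_measurable borel"
  shows "(\<integral>\<^sup>+x. h (- x) \<partial>lborel) = (\<integral>\<^sup>+x. h x \<partial>lborel)"
proof -
  have "distr lborel borel uminus = (lborel :: 'a measure)"
    using lborel_affine[of "-1" "0::'a"] by (simp add: density_1)
  then have "(\<integral>\<^sup>+x. h x \<partial>lborel) = (\<integral>\<^sup>+x. h x \<partial>distr lborel borel uminus)"
    by simp
  then show ?thesis by (simp add: nn_integral_distr)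
qed

text \<open>
  The change of variables in HOL-Analysis needs a well-ordered index type. Instead, as in the proof of
  uniqueness of Haar measure, translation invariance and Fubini give \<open>(\<integral>h \<circ> f) (\<integral>g) = (\<integral>h) (\<integral>g \<circ> f)\<close>, and
  the indicator \<open>g\<close> of the unit ball is invariant under \<open>f\<close>.
\<close>

lemma nn_integral_lborel_orthogonal:
  fixes f :: "'a::euclidean_space \<Rightarrow> 'a"
  assumes f: "orthogonal_transformation f" and h[measurable]: "h \<in> borel_measurable borel"
  shows "(\<integral>\<^sup>+x. h (f x) \<partial>lborel) = (\<integral>\<^sup>+x. h x \<partial>lborel)"
proof -
  have lin: "linear f" and norm_f: "norm (f x) = norm x" for x
    using f by (auto simp: orthogonal_transformation)
  have fm[measurable]: "f \<in> borel_measurable borel"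
    using lin by (simp add: borel_measurable_continuous_onI linear_continuous_on linear_conv_bounded_linear)
  \<comment> \<open>With \<open>k\<close>, translating \<open>x\<close> by \<open>k y\<close>
    translates \<open>f x\<close> by \<open>y\<close>.\<close>
  obtain k where k: "f (k y) = y" for y
    using orthogonal_transformation_surj[OF f] by (metis surjD)
  define g :: "'a \<Rightarrow> ennreal" where "g = indicator (ball 0 1)"
  have gm[measurable]: "g \<in> borel_measurable borel" by (simp add: g_def borel_measurable_indicator borel_open)
  have g_norm: "g x = g y" if "norm x = norm y" for x y
    using that by (simp add: g_def indicator_def)
  define c where "c = (\<integral>\<^sup>+x. g x \<partial>lborel)"
  have c: "c \<noteq> 0" "c \<noteq> \<infinity>"
    using emeasure_bounded_finite[of "ball 0 1 :: 'a set"] content_ball_pos[of 1 "0::'a"]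
    by (auto simp: c_def g_def emeasure_eq_measure2 measure_def)
  have "(\<integral>\<^sup>+x. h (f x) \<partial>lborel) * c = (\<integral>\<^sup>+y. (\<integral>\<^sup>+x. h (f x) * g y \<partial>lborel) \<partial>lborel)"
    by (simp add: c_def nn_integral_cmult nn_integral_multc)
  also have "\<dots> = (\<integral>\<^sup>+y. (\<integral>\<^sup>+x. h (y + f x) * g y \<partial>lborel) \<partial>lborel)"
  proof (rule nn_integral_cong)
    fix y :: 'a
    have "(\<integral>\<^sup>+x. h (f x) * g y \<partial>lborel) = (\<integral>\<^sup>+x. h (f (k y + x)) * g y \<partial>lborel)"
      by (rule nn_integral_lborel_shift[symmetric]) measurable
    then show "(\<integral>\<^sup>+x. h (f x) * g y \<partial>lborel) = (\<integral>\<^sup>+x. h (y + f x) * g y \<partial>lborel)"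
      by (simp add: linear_add[OF lin] k)
  qed
  also have "\<dots> = (\<integral>\<^sup>+x. (\<integral>\<^sup>+y. h (y + f x) * g y \<partial>lborel) \<partial>lborel)"
    by (rule lborel_pair.Fubini') measurable
  also have "\<dots> = (\<integral>\<^sup>+x. (\<integral>\<^sup>+y. h y * g (y - f x) \<partial>lborel) \<partial>lborel)"
  proof (rule nn_integral_cong)
    fix x :: 'a
    have "(\<integral>\<^sup>+y. h y * g (y - f x) \<partial>lborel) = (\<integral>\<^sup>+y. h (f x + y) * g ((f x + y) - f x) \<partial>lborel)"
      by (rule nn_integral_lborel_shift[symmetric]) measurable
    then show "(\<integral>\<^sup>+y. h (y + f x) * g y \<partial>lborel) = (\<integral>\<^sup>+y. h y * g (y - f x) \<partial>lborel)"
      by (simp add: add.commute)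
  qed
  also have "\<dots> = (\<integral>\<^sup>+y. (\<integral>\<^sup>+x. h y * g (y - f x) \<partial>lborel) \<partial>lborel)"
    by (rule lborel_pair.Fubini') measurable
  also have "\<dots> = (\<integral>\<^sup>+y. h y * c \<partial>lborel)"
  proof (rule nn_integral_cong)
    fix y :: 'a
    \<comment> \<open>As \<open>y - f x = f (k y - x)\<close> and \<open>f\<close> preserves norms,
      the rotation disappears from the radial function \<open>g\<close>.\<close>
    have "(\<integral>\<^sup>+x. g (y - f x) \<partial>lborel) = (\<integral>\<^sup>+x. g (k y - x) \<partial>lborel)"
      by (intro nn_integral_cong g_norm) (metis k lin linear_diff norm_f)
    also have "\<dots> = (\<integral>\<^sup>+x. g (k y + x) \<partial>lborel)"
      using nn_integral_lborel_uminus[of "\<lambda>x. g (k y + x)"] by simp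
    also have "\<dots> = c"
      unfolding c_def by (rule nn_integral_lborel_shift) measurable
    finally show "(\<integral>\<^sup>+x. h y * g (y - f x) \<partial>lborel) = h y * c"
      by (simp add: nn_integral_cmult)
  qed
  also have "\<dots> = (\<integral>\<^sup>+y. h y \<partial>lborel) * c"
    by (simp add: nn_integral_multc)
  finally show ?thesis
    using c by (simp add: ennreal_mult_cancel_left mult.commute[of _ c])
qed

lemma nn_integral_gaussian_1:
  assumes "a > 0"
  shows "(\<integral>\<^sup>+y. ennreal (exp (- (a * y\<^sup>2 / 2))) \<partial>lborel) = ennreal (sqrt (2 * pi / a))"
proof -
  define \<sigma> where "\<sigma> = 1 / sqrt a"
  have \<sigma>: "\<sigma> > 0" "\<sigma>\<^sup>2 = 1 / a" using assms by (auto simp: \<sigma>_def power_divide)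
  have "exp (- (a * y\<^sup>2 / 2)) = sqrt (2 * pi / a) * normal_density 0 \<sigma> y" for y
    unfolding normal_density_def \<sigma>(2) using assms by (simp add: real_sqrt_divide real_sqrt_mult)
  then have "(\<integral>\<^sup>+y. ennreal (exp (- (a * y\<^sup>2 / 2))) \<partial>lborel) =
      (\<integral>\<^sup>+y. ennreal (sqrt (2 * pi / a)) * ennreal (normal_density 0 \<sigma> y) \<partial>lborel)"
    using assms by (simp add: ennreal_mult)
  also have "\<dots> = ennreal (sqrt (2 * pi / a)) * (\<integral>\<^sup>+y. ennreal (normal_density 0 \<sigma> y) \<partial>lborel)"
    by (rule nn_integral_cmult) simp
  also have "(\<integral>\<^sup>+y. ennreal (normal_density 0 \<sigma> y) \<partial>lborel) = 1"
    using \<sigma> by (subst nn_integral_eq_integral) (auto simp: normal_density_nonneg)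
  finally show ?thesis by simp
qed

lemma prod_Basis_vec:
  fixes F :: "real^'n \<Rightarrow> 'b::comm_monoid_mult"
  shows "(\<Prod>b\<in>Basis. F b) = (\<Prod>i\<in>UNIV. F (axis i 1))"
proof -
  have "inj (\<lambda>i::'n. axis i (1::real))" by (auto simp: inj_def axis_eq_axis)
  then have "prod F (range (\<lambda>i. axis i 1)) = (\<Prod>i\<in>UNIV. F (axis i 1))"
    by (simp add: prod.reindex)
  moreover have "(Basis :: (real^'n) set) = range (\<lambda>i. axis i 1)" by (auto simp: Basis_vec_def)
  ultimately show ?thesis by simp
qed

lemma nn_integral_lborel_vec_prod:
  fixes F :: "'n::finite \<Rightarrow> real \<Rightarrow> ennreal"
  assumes [measurable]: "\<And>i. F i \<in> borel_measurable borel"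
  shows "(\<integral>\<^sup>+x. (\<Prod>i\<in>UNIV. F i (x $ i)) \<partial>(lborel :: (real^'n) measure)) = (\<Prod>i\<in>UNIV. \<integral>\<^sup>+y. F i y \<partial>lborel)"
proof -
  \<comment> \<open>Recovers the coordinate from its basis vector, since the product formula for
    \<open>lborel\<close> is indexed by \<open>Basis\<close>.\<close>
  define k where "k = inv (\<lambda>i::'n. axis i (1::real))"
  have k: "k (axis i 1) = i" for i
    unfolding k_def by (rule inv_f_f) (auto simp: inj_def axis_eq_axis)
  have "(\<integral>\<^sup>+x. (\<Prod>b\<in>Basis. F (k b) (x \<bullet> b)) \<partial>(lborel :: (real^'n) measure)) = (\<Prod>b\<in>(Basis :: (real^'n) set). \<integral>\<^sup>+y. F (k b) y \<partial>lborel)"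
    by (rule nn_integral_lborel_prod) auto
  then show ?thesis by (simp add: prod_Basis_vec k inner_axis)
qed

lemma inner_diag_mat: "x \<bullet> (diag_mat d *v x) = (\<Sum>i\<in>UNIV. d i * (x $ i)\<^sup>2)"
  by (simp add: inner_vec_def matrix_vector_mult_def if_distrib[of "\<lambda>x. x * _"] if_distrib[of "\<lambda>x. _ * x"] power2_eq_square mult_ac cong: if_cong)

lemma inner_matrix_congruence:
  fixes C M :: "real^'n^'n"
  shows "x \<bullet> ((transpose M ** C ** M) *v x) = (M *v x) \<bullet> (C *v (M *v x))"
  by (simp add: matrix_vector_mul_assoc[symmetric] dot_lmul_matrix[symmetric] inner_commute)
     (metis dot_lmul_matrix inner_commute transpose_matrix_vector)

lemma sym_pos_def_diagonalization:
  fixes Q :: "real^'n^'n"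
  assumes "Q \<in> sym_pos_def"
  obtains U d where "orthogonal_matrix U" "transpose U ** Q ** U = diag_mat d" "\<And>i. d i > 0"
proof -
  have sym: "transpose Q = Q" and pos: "\<And>x. x \<noteq> 0 \<Longrightarrow> 0 < x \<bullet> (Q *v x)"
    using assms by (auto simp: sym_pos_def_def)
  obtain U d where U: "orthogonal_matrix U" "transpose U ** Q ** U = diag_mat d"
    using symmetric_matrix_diagonalization[OF sym] by blast
  have "d i > 0" for i
  proof -
    \<comment> \<open>The number \<open>d i\<close> is the value of the quadratic form of
      \<open>Q\<close> at column \<open>i\<close> of \<open>U\<close>, which is nonzero.\<close>
    have "U *v axis i 1 \<noteq> 0"
      by (metis U(1) axis_eq_0_iff matrix_left_invertible_ker orthogonal_matrix zero_neq_one)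
    from pos[OF this] have "0 < axis i 1 \<bullet> (diag_mat d *v axis i 1)"
      by (simp flip: U(2) add: inner_matrix_congruence)
    then show ?thesis
      by (simp add: inner_diag_mat axis_def if_distrib[of "\<lambda>x. x ^ 2"] if_distrib[of "\<lambda>x. _ * x"] cong: if_cong)
  qed
  with U that show ?thesis by blast
qed

lemma det_sym_pos_def:
  assumes "orthogonal_matrix U" "transpose U ** Q ** U = diag_mat d"
  shows "det Q = prod d UNIV"
proof -
  have "det (transpose U ** Q ** U) = det U * det U * det Q" by (simp add: det_mul)
  moreover have "det U * det U = 1"
    using det_orthogonal_matrix[OF assms(1)] by auto
  ultimately show ?thesis using assms(2) by simp
qed

lemma sqrt_prod: "sqrt (\<Prod>x\<in>A. f x) = (\<Prod>x\<in>A. sqrt (f x))"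
  by (induction A rule: infinite_finite_induct) (auto simp: real_sqrt_mult)

text \<open>The rotation \<open>U\<close> preserves the integral and diagonalizes the form, which
  leaves a product of one-dimensional Gaussian integrals.\<close>

lemma nn_integral_gaussian_form:
  fixes Q :: "real^'n^'n"
  assumes "Q \<in> sym_pos_def"
  shows "(\<integral>\<^sup>+x. ennreal (exp (- (x \<bullet> (Q *v x)) / 2)) \<partial>lborel) = ennreal (sqrt ((2 * pi) ^ CARD('n) / det Q))"
proof -
  obtain U d where U: "orthogonal_matrix U" "transpose U ** Q ** U = diag_mat d" and d: "\<And>i. d i > 0"
    using sym_pos_def_diagonalization[OF assms] by blast
  have orth: "orthogonal_transformation ((*v) U)"
    using U(1) by (simp add: orthogonal_transformation_matrix)
  have [measurable]: "(*v) Q \<in> borel_measurable borel"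
    by (simp add: borel_measurable_continuous_onI matrix_vector_mult_linear_continuous_on)
  have "(\<integral>\<^sup>+x. ennreal (exp (- (x \<bullet> (Q *v x)) / 2)) \<partial>lborel) =
      (\<integral>\<^sup>+x. ennreal (exp (- ((U *v x) \<bullet> (Q *v (U *v x))) / 2)) \<partial>lborel)"
    by (rule nn_integral_lborel_orthogonal[OF orth, symmetric]) measurable
  also have "\<dots> = (\<integral>\<^sup>+x. (\<Prod>i\<in>UNIV. ennreal (exp (- (d i * (x $ i)\<^sup>2) / 2))) \<partial>lborel)"
    by (simp add: inner_matrix_congruence[symmetric] U(2) inner_diag_mat prod_ennreal
        exp_sum[symmetric] sum_divide_distrib sum_negf)
  also have "\<dots> = (\<Prod>i\<in>UNIV. ennreal (sqrt (2 * pi / d i)))"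
    by (subst nn_integral_lborel_vec_prod) (simp_all add: nn_integral_gaussian_1 d)
  also have "\<dots> = ennreal (sqrt (\<Prod>i\<in>UNIV. 2 * pi / d i))"
    using d by (simp add: prod_ennreal less_imp_le sqrt_prod)
  also have "(\<Prod>i\<in>UNIV. 2 * pi / d i) = (2 * pi) ^ CARD('n) / det Q"
    by (simp add: prod_dividef det_sym_pos_def[OF U])
  finally show ?thesis .
qed

section \<open>Tails of Gaussian quadratic forms\<close>


text \<open>With \<open>D\<close> the root of the eigenvalues of \<Sigma>, \<open>U ** D\<close> is
  a square root of \<Sigma>. An orthogonal \<open>V\<close> that diagonalizes the transported
  \<open>B\<close> cancels in \<open>M ** transpose M\<close>, so it can be appended to this
  root.\<close>

lemma sym_pos_def_simultaneous_diagonalization: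
  fixes \<Sigma> B :: "real^'n^'n"
  assumes "\<Sigma> \<in> sym_pos_def" and B: "transpose B = B"
  obtains M :: "real^'n^'n" and \<mu> where "M ** transpose M = \<Sigma>" "transpose M ** B ** M = diag_mat \<mu>"
proof -
  obtain U d where U: "orthogonal_matrix U" "transpose U ** \<Sigma> ** U = diag_mat d" and d: "\<And>i. d i > 0"
    using sym_pos_def_diagonalization[OF assms(1)] by blast
  have UU: "U ** transpose U = mat 1" using U(1) by (simp add: orthogonal_matrix_def)
  define D where "D = diag_mat (\<lambda>i. sqrt (d i))"
  have DD: "D ** D = diag_mat d" using d by (simp add: D_def diag_mat_mult less_imp_le)
  have DT: "transpose D = D" by (simp add: D_def)
  have "U ** D ** (D ** transpose U) = U ** (D ** D) ** transpose U"
    by (simp add: matrix_mul_assoc)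
  also have "\<dots> = (U ** transpose U) ** \<Sigma> ** (U ** transpose U)"
    unfolding DD U(2)[symmetric] by (simp add: matrix_mul_assoc)
  finally have NN: "U ** D ** transpose (U ** D) = \<Sigma>"
    by (simp add: matrix_transpose_mul DT UU)
  have "transpose (transpose (U ** D) ** B ** (U ** D)) = transpose (U ** D) ** B ** (U ** D)"
    by (simp add: matrix_transpose_mul B matrix_mul_assoc)
  then obtain V \<mu> where V: "orthogonal_matrix V"
      "transpose V ** (transpose (U ** D) ** B ** (U ** D)) ** V = diag_mat \<mu>"
    using symmetric_matrix_diagonalization by blast
  have VV: "V ** transpose V = mat 1" using V(1) by (simp add: orthogonal_matrix_def)
  show ?thesis
  proof (rule that[of "U ** D ** V" \<mu>])
    have "U ** D ** V ** transpose (U ** D ** V) = U ** D ** (V ** transpose V) ** transpose (U ** D)"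
      by (simp add: matrix_transpose_mul matrix_mul_assoc)
    then show "U ** D ** V ** transpose (U ** D ** V) = \<Sigma>"
      using NN by (simp add: VV)
    show "transpose (U ** D ** V) ** B ** (U ** D ** V) = diag_mat \<mu>"
      using V(2) by (simp add: matrix_transpose_mul matrix_mul_assoc)
  qed
qed

lemma sym_pos_def_invertible:
  fixes \<Sigma> :: "real^'n^'n"
  assumes "\<Sigma> \<in> sym_pos_def"
  shows "invertible \<Sigma>"
proof -
  have "x = 0" if "\<Sigma> *v x = 0" for x
  proof (rule ccontr)
    assume "x \<noteq> 0"
    then have "0 < x \<bullet> (\<Sigma> *v x)" using assms by (auto simp: sym_pos_def_def)
    then show False using that by simp
  qed
  then show ?thesis
    using matrix_left_invertible_ker invertible_left_inverse by blast
qed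

lemma matrix_mul_matrix_inv:
  fixes A :: "real^'n^'n"
  assumes "invertible A"
  shows "A ** matrix_inv A = mat 1"
  using someI_ex[OF assms[unfolded invertible_def]] by (simp add: matrix_inv_def)

lemma matrix_inv_congruence:
  fixes \<Sigma> M :: "real^'n^'n"
  assumes "\<Sigma> \<in> sym_pos_def" and M: "M ** transpose M = \<Sigma>"
  shows "transpose M ** matrix_inv \<Sigma> ** M = mat 1"
    and "M ** (transpose M ** matrix_inv \<Sigma>) = mat 1"
proof -
  have "\<Sigma> ** matrix_inv \<Sigma> = mat 1"
    using sym_pos_def_invertible[OF assms(1)] by (rule matrix_mul_matrix_inv)
  then show *: "M ** (transpose M ** matrix_inv \<Sigma>) = mat 1"
    by (simp add: M matrix_mul_assoc)
  then show "transpose M ** matrix_inv \<Sigma> ** M = mat 1"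
    by (simp add: matrix_left_right_inverse[of M])
qed

lemma matrix_add_mult_distrib:
  fixes A B C :: "real^'n^'n"
  shows "(A + B) ** C = A ** C + B ** C"
  by (simp add: matrix_matrix_mult_def vec_eq_iff sum.distrib algebra_simps)

lemma sets_gaussian [measurable_cong, simp]: "sets (gaussian \<Sigma>) = sets borel"
  and space_gaussian [simp]: "space (gaussian \<Sigma>) = UNIV"
  by (simp_all add: gaussian_def)

lemma borel_measurable_matrix_vector_mult [measurable]:
  "(*v) (A :: real^'n^'m) \<in> borel_measurable borel"
  by (simp add: borel_measurable_continuous_onI matrix_vector_mult_linear_continuous_on)

text \<open>The exponential is absorbed into the density, which turns the precision matrix
  \<open>P\<close> into \<open>Q = P + 2cB\<close>. In the coordinates \<open>x = M *v y\<close>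
  this \<open>Q\<close> is diagonal with entries \<open>1 + 2 * c * \<mu> i\<close>; hence it is
  positive definite, and the product of these entries is
  \<open>det \<Sigma> * det Q\<close>.\<close>

lemma nn_integral_gaussian_exp_form:
  fixes \<Sigma> B M :: "real^'n^'n"
  assumes \<Sigma>: "\<Sigma> \<in> sym_pos_def" and B: "transpose B = B" and M: "M ** transpose M = \<Sigma>"
    and \<mu>: "transpose M ** B ** M = diag_mat \<mu>" and pos: "\<And>i. 1 + 2 * c * \<mu> i > 0"
  shows "(\<integral>\<^sup>+x. ennreal (exp (- c * (x \<bullet> (B *v x)))) \<partial>gaussian \<Sigma>) = ennreal (1 / sqrt (\<Prod>i\<in>UNIV. 1 + 2 * c * \<mu> i))"
proof -
  define P where "P = matrix_inv \<Sigma>"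
  define Q where "Q = P + (2 * c) *\<^sub>R B"
  have PM: "transpose M ** P ** M = mat 1" "M ** (transpose M ** P) = mat 1"
    using matrix_inv_congruence[OF \<Sigma> M] by (auto simp: P_def)
  have "transpose \<Sigma> = \<Sigma>" using \<Sigma> by (simp add: sym_pos_def_def)
  then have "transpose P ** \<Sigma> = mat 1"
    using matrix_mul_matrix_inv[OF sym_pos_def_invertible[OF \<Sigma>]]
    by (metis P_def matrix_transpose_mul transpose_mat)
  then have PT: "transpose P = P"
    by (metis P_def \<Sigma> matrix_mul_matrix_inv matrix_mul_assoc matrix_mul_lid matrix_mul_rid sym_pos_def_invertible)
  have Qx: "x \<bullet> (Q *v x) = x \<bullet> (P *v x) + 2 * c * (x \<bullet> (B *v x))" for x
    by (simp add: Q_def matrix_vector_mult_add_rdistrib inner_add_right scaleR_matrix_vector_assoc[symmetric])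
  have MQM: "transpose M ** Q ** M = diag_mat (\<lambda>i. 1 + 2 * c * \<mu> i)"
  proof -
    have "transpose M ** Q ** M = transpose M ** P ** M + (2 * c) *\<^sub>R (transpose M ** B ** M)"
      by (simp add: Q_def matrix_add_ldistrib matrix_add_mult_distrib scalar_matrix_assoc matrix_scalar_ac)
    then show ?thesis by (simp add: PM \<mu> vec_eq_iff mat_def)
  qed
  have detM: "det M * det M = det \<Sigma>" by (simp flip: M add: det_mul)
  have "det (transpose M ** Q ** M) = det M * det M * det Q" by (simp add: det_mul)
  then have detQ: "det \<Sigma> * det Q = (\<Prod>i\<in>UNIV. 1 + 2 * c * \<mu> i)" by (simp add: MQM detM)
  have "Q \<in> sym_pos_def"
    unfolding sym_pos_def_def
  proof (intro CollectI conjI allI impI)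
    show "transpose Q = Q"
      using PT B by (simp add: Q_def vec_eq_iff transpose_def)
    fix x :: "real^'n" assume "x \<noteq> 0"
    define y where "y = (transpose M ** P) *v x"
    have x: "x = M *v y" by (simp add: y_def matrix_vector_mul_assoc PM)
    have "x \<bullet> (Q *v x) = (\<Sum>i\<in>UNIV. (1 + 2 * c * \<mu> i) * (y $ i)\<^sup>2)"
      by (simp add: x inner_matrix_congruence[symmetric] MQM inner_diag_mat)
    moreover obtain i where "y $ i \<noteq> 0"
      using \<open>x \<noteq> 0\<close> x by (metis matrix_vector_mult_0_right vec_eq_iff zero_index)
    then have "0 < (\<Sum>i\<in>UNIV. (1 + 2 * c * \<mu> i) * (y $ i)\<^sup>2)"
      using pos by (intro sum_pos2[of _ i]) (auto simp: less_imp_le)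
    ultimately show "0 < x \<bullet> (Q *v x)" by simp
  qed
  from nn_integral_gaussian_form[OF this]
  have int: "(\<integral>\<^sup>+x. ennreal (exp (- (x \<bullet> (Q *v x)) / 2)) \<partial>lborel) = ennreal (sqrt ((2 * pi) ^ CARD('n) / det Q))" .
  define k where "k = 1 / sqrt ((2 * pi) ^ CARD('n) * det \<Sigma>)"
  have det\<Sigma>: "det \<Sigma> > 0"
  proof -
    have "det M \<noteq> 0" using PM by (metis det_I det_mul mult_zero_left zero_neq_one)
    then show ?thesis by (simp flip: detM add: zero_less_mult_iff) linarith
  qed
  have "(\<integral>\<^sup>+x. ennreal (exp (- c * (x \<bullet> (B *v x)))) \<partial>gaussian \<Sigma>) =
      (\<integral>\<^sup>+x. ennreal (exp (- (x \<bullet> (P *v x)) / 2) * k) * ennreal (exp (- c * (x \<bullet> (B *v x)))) \<partial>lborel)"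
    unfolding gaussian_def P_def[symmetric] by (subst nn_integral_density) (simp_all add: k_def)
  also have "\<dots> = (\<integral>\<^sup>+x. ennreal k * ennreal (exp (- (x \<bullet> (Q *v x)) / 2)) \<partial>lborel)"
    using det\<Sigma> by (intro nn_integral_cong) (simp add: k_def ennreal_mult[symmetric] Qx exp_add[symmetric] field_simps)
  also have "\<dots> = ennreal k * ennreal (sqrt ((2 * pi) ^ CARD('n) / det Q))"
    unfolding int[symmetric] by (rule nn_integral_cmult) measurable
  also have "\<dots> = ennreal (1 / sqrt (det \<Sigma> * det Q))"
    using det\<Sigma> by (simp add: k_def ennreal_mult'[symmetric] real_sqrt_mult real_sqrt_divide)
  finally show ?thesis by (simp add: detQ)
qed

lemma prob_space_gaussian:
  fixes \<Sigma> :: "real^'n^'n"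
  assumes "\<Sigma> \<in> sym_pos_def"
  shows "prob_space (gaussian \<Sigma>)"
proof
  obtain M :: "real^'n^'n" and \<mu> where M: "M ** transpose M = \<Sigma>" "transpose M ** mat 1 ** M = diag_mat \<mu>"
    using sym_pos_def_simultaneous_diagonalization[OF assms, of "mat 1"] by auto
  \<comment> \<open>At \<open>c = 0\<close> both the integrand and the value of the Laplace
    transform are 1.\<close>
  have "(\<integral>\<^sup>+x. 1 \<partial>gaussian \<Sigma>) = 1"
    using nn_integral_gaussian_exp_form[OF assms transpose_mat M, of 0] by simp
  then show "emeasure (gaussian \<Sigma>) (space (gaussian \<Sigma>)) = 1" by simp
qed

lemma prob_space_iid_gaussian:
  "\<Sigma> \<in> sym_pos_def \<Longrightarrow> prob_space (iid_gaussian n \<Sigma>)"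
  unfolding iid_gaussian_def by (intro prob_space_PiM prob_space_gaussian)

lemma measurable_iid_gaussian_component [measurable]:
  "k \<in> {1..n} \<Longrightarrow> (\<lambda>X. X k) \<in> borel_measurable (iid_gaussian n \<Sigma>)"
  unfolding iid_gaussian_def
  by (subst measurable_cong_sets[OF refl sets_gaussian[symmetric]]) measurable

text \<open>Markov's inequality for \<open>exp (- c * Q)\<close>, \<open>Q\<close> being the sum of
  the forms; by independence its expectation is the \<open>n\<close>-th power of the Laplace
  transform of one form. Upper tails are obtained by changing the sign of \<open>B\<close>.\<close>

lemma gaussian_form_chernoff:
  fixes \<Sigma> B M :: "real^'n^'n"
  assumes \<Sigma>: "\<Sigma> \<in> sym_pos_def" and B: "transpose B = B" and M: "M ** transpose M = \<Sigma>"
    and \<mu>: "transpose M ** B ** M = diag_mat \<mu>" and c: "c \<ge> 0" and pos: "\<And>i. 1 + 2 * c * \<mu> i > 0"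
  shows "\<P>(X in iid_gaussian n \<Sigma>. (\<Sum>k=1..n. X k \<bullet> (B *v X k)) \<le> t)
    \<le> exp (c * t - real n * (\<Sum>i\<in>UNIV. ln (1 + 2 * c * \<mu> i)) / 2)"
proof -
  interpret G: prob_space "gaussian \<Sigma>" by (rule prob_space_gaussian[OF \<Sigma>])
  interpret product_prob_space "\<lambda>_::nat. gaussian \<Sigma>" "{1..n}" by standard
  define q where "q = sqrt (\<Prod>i\<in>UNIV. 1 + 2 * c * \<mu> i)"
  have prod_pos: "(\<Prod>i\<in>UNIV. 1 + 2 * c * \<mu> i) > 0" by (intro prod_pos pos)
  have q: "q = exp ((\<Sum>i\<in>UNIV. ln (1 + 2 * c * \<mu> i)) / 2)"
  proof -
    have "ln q = (\<Sum>i\<in>UNIV. ln (1 + 2 * c * \<mu> i)) / 2"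
      using prod_pos by (simp add: q_def ln_sqrt ln_prod pos less_imp_neq[OF pos, symmetric])
    then show ?thesis using prod_pos by (metis exp_ln q_def real_sqrt_gt_0_iff)
  qed
  let ?E = "{X \<in> space (iid_gaussian n \<Sigma>). (\<Sum>k=1..n. X k \<bullet> (B *v X k)) \<le> t}"
  have [measurable]: "?E \<in> sets (iid_gaussian n \<Sigma>)" by measurable
  have "emeasure (iid_gaussian n \<Sigma>) ?E = (\<integral>\<^sup>+X. indicator ?E X \<partial>iid_gaussian n \<Sigma>)"
    by simp
  also have "\<dots> \<le> (\<integral>\<^sup>+X. ennreal (exp (c * t)) * (\<Prod>k\<in>{1..n}. ennreal (exp (- c * (X k \<bullet> (B *v X k))))) \<partial>iid_gaussian n \<Sigma>)"
  proof (rule nn_integral_mono)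
    fix X
    have "1 \<le> exp (c * t) * (\<Prod>k\<in>{1..n}. exp (- c * (X k \<bullet> (B *v X k))))"
      if "(\<Sum>k=1..n. X k \<bullet> (B *v X k)) \<le> t"
    proof -
      have "exp (c * t) * (\<Prod>k\<in>{1..n}. exp (- c * (X k \<bullet> (B *v X k)))) =
          exp (c * (t - (\<Sum>k=1..n. X k \<bullet> (B *v X k))))"
        by (simp add: exp_sum[symmetric] exp_add[symmetric] sum_negf sum_distrib_left right_diff_distrib)
      then show ?thesis using that c by simp
    qed
    then show "indicator ?E X \<le> ennreal (exp (c * t)) * (\<Prod>k\<in>{1..n}. ennreal (exp (- c * (X k \<bullet> (B *v X k)))))"
      by (auto simp: indicator_def prod_ennreal ennreal_mult[symmetric] prod_nonneg simp flip: ennreal_1)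
  qed
  also have "\<dots> = ennreal (exp (c * t)) * (\<integral>\<^sup>+X. (\<Prod>k\<in>{1..n}. ennreal (exp (- c * (X k \<bullet> (B *v X k))))) \<partial>iid_gaussian n \<Sigma>)"
    by (rule nn_integral_cmult) measurable
  also have "(\<integral>\<^sup>+X. (\<Prod>k\<in>{1..n}. ennreal (exp (- c * (X k \<bullet> (B *v X k))))) \<partial>iid_gaussian n \<Sigma>) =
      (\<Prod>k\<in>{1..n}. \<integral>\<^sup>+x. ennreal (exp (- c * (x \<bullet> (B *v x)))) \<partial>gaussian \<Sigma>)"
    unfolding iid_gaussian_def
  proof (rule product_nn_integral_prod)
    have "(\<lambda>x. ennreal (exp (- c * (x \<bullet> (B *v x))))) \<in> borel_measurable borel" by measurable
    then show "(\<lambda>x. ennreal (exp (- c * (x \<bullet> (B *v x))))) \<in> borel_measurable (gaussian \<Sigma>)"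
      by (simp cong: measurable_cong_sets)
  qed simp
  also have "\<dots> = ennreal (1 / q) ^ n"
    by (subst nn_integral_gaussian_exp_form[OF \<Sigma> B M \<mu> pos]) (simp_all add: q_def)
  also have "ennreal (exp (c * t)) * ennreal (1 / q) ^ n = ennreal (exp (c * t) * (1 / q) ^ n)"
    by (simp add: q ennreal_power ennreal_mult)
  also have "exp (c * t) * (1 / q) ^ n = exp (c * t - real n * (\<Sum>i\<in>UNIV. ln (1 + 2 * c * \<mu> i)) / 2)"
    by (simp add: q exp_diff power_divide exp_of_nat_mult[symmetric])
  finally show ?thesis
    unfolding measure_def by (intro enn2real_leI) auto
qed

text \<open>The difference \<open>f\<close> of the two sides has a derivative with the sign of
  \<open>x\<close> on \<open>x \<ge> - \<beta>\<close>, so it is least at 0, where it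
  vanishes.\<close>

lemma ln_one_plus_quadratic_lower_bound:
  fixes w \<beta> :: real
  assumes "0 \<le> \<beta>" "\<beta> < 1" "- \<beta> \<le> w"
  shows "w - w\<^sup>2 / (2 * (1 - \<beta>)) \<le> ln (1 + w)"
proof -
  define f where "f x = ln (1 + x) - x + x\<^sup>2 / (2 * (1 - \<beta>))" for x
  define f' where "f' x = x * (1 / (1 - \<beta>) - 1 / (1 + x))" for x
  have D: "(f has_real_derivative f' x) (at x)" if "- \<beta> \<le> x" for x
    unfolding f_def f'_def using that assms
    by (auto intro!: derivative_eq_intros simp: divide_simps) (simp add: algebra_simps)
  have sgn: "1 / (1 - \<beta>) - 1 / (1 + x) \<ge> 0" if "- \<beta> \<le> x" for x
    using that assms by (simp add: frac_le)
  have "f 0 \<le> f w"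
  proof (cases "0 \<le> w")
    case True
    show ?thesis
    proof (rule DERIV_nonneg_imp_nondecreasing[OF True], intro exI conjI)
      fix x assume "0 \<le> x" "x \<le> w"
      then show "(f has_real_derivative f' x) (at x)" "0 \<le> f' x"
        using D[of x] sgn[of x] assms by (auto simp: f'_def intro!: mult_nonneg_nonneg)
    qed
  next
    case False
    then have "w \<le> 0" by simp
    then show ?thesis
    proof (rule DERIV_nonpos_imp_nonincreasing, intro exI conjI)
      fix x assume "w \<le> x" "x \<le> 0"
      then show "(f has_real_derivative f' x) (at x)" "f' x \<le> 0"
        using D[of x] sgn[of x] assms by (auto simp: f'_def intro!: mult_nonpos_nonneg)
    qed
  qed
  then show ?thesis by (simp add: f_def)
qed

text \<open>The constants are those of Laurent and Massart for weighted chi-square variables.\<close>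

lemma gaussian_form_lower_tail:
  fixes \<Sigma> B M :: "real^'n^'n"
  assumes \<Sigma>: "\<Sigma> \<in> sym_pos_def" and B: "transpose B = B" and M: "M ** transpose M = \<Sigma>"
    and \<mu>: "transpose M ** B ** M = diag_mat \<mu>"
    and n: "n \<ge> 1" and z: "z \<ge> 0" and v: "v > 0" "(\<Sum>i\<in>UNIV. (\<mu> i)\<^sup>2) \<le> v" and b: "b \<ge> 0" "\<And>i. - b \<le> \<mu> i"
    and \<delta>: "\<delta> \<ge> 2 * sqrt (v * (z / n)) + 2 * b * (z / n)"
  shows "\<P>(X in iid_gaussian n \<Sigma>. (\<Sum>k=1..n. X k \<bullet> (B *v X k)) \<le> n * (sum \<mu> UNIV - \<delta>)) \<le> exp (- z)"
proof -
  define y where "y = sqrt (z / n)"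
  define w where "w = sqrt v"
  have y: "y \<ge> 0" "y\<^sup>2 = z / n" using z by (auto simp: y_def)
  have w: "w > 0" "w\<^sup>2 = v" using v by (auto simp: w_def)
  define d where "d = w + 2 * b * y"
  have d: "d > 0" using w y b by (simp add: d_def add_pos_nonneg)
  \<comment> \<open>This choice gives \<open>1 - \<beta> = w / d\<close>. The quadratic loss is then
    \<open>y\<^sup>2 * w / d\<close>, while the gain \<open>c * \<delta>\<close> is at least
    \<open>y\<^sup>2 * w / d + y\<^sup>2\<close>, so that exactly \<open>y\<^sup>2 = z / n\<close>
    remains per observation.\<close>
  define c where "c = y / d"
  define \<beta> where "\<beta> = 2 * c * b"
  have c: "c \<ge> 0" using y d by (simp add: c_def)
  have \<beta>: "0 \<le> \<beta>" "1 - \<beta> = w / d" "\<beta> < 1"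
    using b c d w by (auto simp: \<beta>_def c_def d_def field_simps)
  have lo: "- \<beta> \<le> 2 * c * \<mu> i" for i
    using mult_left_mono[OF b(2), of "2 * c" i] c by (simp add: \<beta>_def)
  have \<delta>': "\<delta> \<ge> 2 * w * y + 2 * b * y\<^sup>2"
    using \<delta> unfolding real_sqrt_mult y(2) by (simp add: w_def y_def)
  have "(\<Sum>i\<in>UNIV. 2 * c * \<mu> i - (2 * c * \<mu> i)\<^sup>2 / (2 * (1 - \<beta>))) \<le> (\<Sum>i\<in>UNIV. ln (1 + 2 * c * \<mu> i))"
    by (intro sum_mono ln_one_plus_quadratic_lower_bound \<beta> lo)
  moreover have "(\<Sum>i\<in>UNIV. 2 * c * \<mu> i - (2 * c * \<mu> i)\<^sup>2 / (2 * (1 - \<beta>))) =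
      2 * c * sum \<mu> UNIV - 2 * c\<^sup>2 / (1 - \<beta>) * (\<Sum>i\<in>UNIV. (\<mu> i)\<^sup>2)"
  proof -
    have "(2 * c * \<mu> i)\<^sup>2 / (2 * (1 - \<beta>)) = 2 * c\<^sup>2 / (1 - \<beta>) * (\<mu> i)\<^sup>2" for i
      using \<beta>(3) by (simp add: power_mult_distrib divide_simps)
    then show ?thesis by (simp add: sum_subtractf sum_distrib_left)
  qed
  moreover have "2 * c\<^sup>2 / (1 - \<beta>) * (\<Sum>i\<in>UNIV. (\<mu> i)\<^sup>2) \<le> 2 * c\<^sup>2 / (1 - \<beta>) * v"
    using v(2) \<beta>(3) by (intro mult_left_mono) auto
  ultimately have L: "2 * c * sum \<mu> UNIV - 2 * c\<^sup>2 / (1 - \<beta>) * v \<le> (\<Sum>i\<in>UNIV. ln (1 + 2 * c * \<mu> i))"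
    by linarith
  have "c\<^sup>2 / (1 - \<beta>) * v = y\<^sup>2 * w / d"
    using w d unfolding \<beta>(2) by (simp add: c_def field_simps power2_eq_square flip: w(2))
  moreover have "c * \<delta> \<ge> c * (2 * w * y + 2 * b * y\<^sup>2)" using c \<delta>' by (rule mult_left_mono[rotated])
  moreover have "c * (2 * w * y + 2 * b * y\<^sup>2) = y\<^sup>2 * w / d + y\<^sup>2"
    using d by (simp add: c_def field_simps power2_eq_square) (simp add: d_def algebra_simps)
  ultimately have E: "- (c * \<delta>) + c\<^sup>2 / (1 - \<beta>) * v \<le> - (z / n)"
    using y by linarith
  have "c * (n * (sum \<mu> UNIV - \<delta>)) - n * (\<Sum>i\<in>UNIV. ln (1 + 2 * c * \<mu> i)) / 2
      \<le> c * (n * (sum \<mu> UNIV - \<delta>)) - n * (2 * c * sum \<mu> UNIV - 2 * c\<^sup>2 / (1 - \<beta>) * v) / 2"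
    using L by (simp add: mult_left_mono divide_right_mono)
  also have "\<dots> = n * (- (c * \<delta>) + c\<^sup>2 / (1 - \<beta>) * v)"
    using \<beta>(3) by (simp add: divide_simps) (simp add: algebra_simps)
  also have "\<dots> \<le> n * (- (z / n))" using E by (rule mult_left_mono) simp
  also have "\<dots> = - z" using n by simp
  finally have "exp (c * (n * (sum \<mu> UNIV - \<delta>)) - n * (\<Sum>i\<in>UNIV. ln (1 + 2 * c * \<mu> i)) / 2) \<le> exp (- z)"
    by simp
  moreover have "1 + 2 * c * \<mu> i > 0" for i using lo[of i] \<beta>(3) by linarith
  ultimately show ?thesis
    using gaussian_form_chernoff[OF \<Sigma> B M \<mu> c, of n "n * (sum \<mu> UNIV - \<delta>)"] by (meson order_trans)
qed

section \<open>Toeplitz matrices\<close>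


definition lag_toeplitz :: "(nat \<Rightarrow> real) \<Rightarrow> real^'p::{finite,linorder}^'p::{finite,linorder}" where
  "lag_toeplitz f = (\<chi> k l. f (lag k l))"

lemma lag_toeplitz_nth [simp]: "lag_toeplitz f $ k $ l = f (lag k l)"
  by (simp add: lag_toeplitz_def)

lemma lag_commute: "lag k l = lag l k"
  by (simp add: lag_def abs_minus_commute)

lemma pos_eq_iff [simp]: "pos k = pos l \<longleftrightarrow> k = l"
  using bij_betw_pos by (auto simp: bij_betw_def inj_def)

lemma pos_less: "pos (k :: 'p::{finite,linorder}) < CARD('p)"
  using bij_betw_pos[where 'p='p] by (auto simp: bij_betw_def)

lemma obtain_pos:
  assumes "m < CARD('p)"
  obtains k :: "'p::{finite,linorder}" where "pos k = m"
  using assms bij_betw_pos[where 'p='p] unfolding bij_betw_def by (metis imageE lessThan_iff)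

lemma lag_eq_0_iff [simp]: "lag k l = 0 \<longleftrightarrow> k = l"
proof -
  have "lag k l = 0 \<longleftrightarrow> pos k = pos l" by (auto simp: lag_def)
  then show ?thesis by simp
qed

lemma lag_less: "lag (k :: 'p::{finite,linorder}) l < CARD('p)"
  using pos_less[of k] pos_less[of l] by (auto simp: lag_def)

lemma card_lag_le: "card {l. lag k l = j} \<le> 2"
proof -
  have "card {l. lag k l = j} = card (pos ` {l. lag k l = j})"
    by (intro card_image[symmetric]) (auto simp: inj_on_def)
  \<comment> \<open>If \<open>pos k < j\<close>, the truncated difference is 0 and merely enlarges
    the covering set.\<close>
  also have "\<dots> \<le> card {pos k + j, pos k - j}"
    by (intro card_mono) (auto simp: lag_def)
  also have "\<dots> \<le> 2" by (simp add: card_insert_if)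
  finally show ?thesis .
qed

text \<open>There are \<open>CARD('p) - j\<close> positions on each of the two diagonals at distance
  \<open>j\<close> from the main one, and these diagonals are disjoint because
  \<open>j \<ge> 1\<close>.\<close>

lemma card_lag_pairs:
  assumes "1 \<le> j" "j < CARD('p::{finite,linorder})"
  shows "card {(k :: 'p, l). lag k l = j} = 2 * (CARD('p) - j)"
proof -
  let ?p = "CARD('p)"
  have "card {(k :: 'p, l). lag k l = j} = card ((\<lambda>(k, l). (pos k, pos l)) ` {(k :: 'p, l). lag k l = j})"
    by (intro card_image[symmetric]) (auto simp: inj_on_def)
  also have "(\<lambda>(k, l). (pos k, pos l)) ` {(k :: 'p, l). lag k l = j} =
      (\<lambda>a. (a, a + j)) ` {..<?p - j} \<union> (\<lambda>a. (a + j, a)) ` {..<?p - j}" (is "?L = ?R")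
  proof
    show "?L \<subseteq> ?R"
    proof
      fix z assume "z \<in> ?L"
      then obtain k l :: 'p where kl: "lag k l = j" "z = (pos k, pos l)" by auto
      then have "pos k = pos l + j \<or> pos l = pos k + j" by (auto simp: lag_def)
      then show "z \<in> ?R"
        using kl(2) pos_less[of k] pos_less[of l] by (auto simp: image_iff)
    qed
    show "?R \<subseteq> ?L"
    proof
      fix z assume "z \<in> ?R"
      then obtain a where a: "a < ?p - j" "z = (a, a + j) \<or> z = (a + j, a)" by auto
      have "a < ?p" "a + j < ?p" using a by auto
      then obtain k l :: 'p where kl: "pos k = a" "pos l = a + j"
        by (metis obtain_pos)
      then have "lag k l = j" "lag l k = j" by (auto simp: lag_def)
      moreover have "z = (pos k, pos l) \<or> z = (pos l, pos k)" using a(2) kl by simp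
      ultimately show "z \<in> ?L" by (auto simp: image_iff)
    qed
  qed
  also have "card \<dots> = card ((\<lambda>a. (a, a + j)) ` {..<?p - j}) + card ((\<lambda>a. (a + j, a)) ` {..<?p - j})"
    using assms by (intro card_Un_disjoint) auto
  also have "\<dots> = 2 * (?p - j)" by (simp add: card_image inj_on_def)
  finally show ?thesis .
qed

lemma sum_lag_pairs:
  fixes h :: "nat \<Rightarrow> real"
  assumes T: "T \<subseteq> {1..<CARD('p::{finite,linorder})}"
    and h: "\<And>i. i < CARD('p) \<Longrightarrow> i \<notin> T \<Longrightarrow> h i = 0"
  shows "(\<Sum>k\<in>UNIV. \<Sum>l\<in>UNIV. h (lag (k :: 'p) l)) = (\<Sum>j\<in>T. 2 * (real CARD('p) - real j) * h j)"
proof -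
  have T': "finite T" using T finite_subset by blast
  have "(\<Sum>k\<in>UNIV. \<Sum>l\<in>UNIV. h (lag (k :: 'p) l)) = (\<Sum>x\<in>(UNIV :: ('p \<times> 'p) set). h (lag (fst x) (snd x)))"
    by (simp add: sum.cartesian_product case_prod_beta)
  also have "\<dots> = (\<Sum>x\<in>{x :: 'p \<times> 'p. lag (fst x) (snd x) \<in> T}. h (lag (fst x) (snd x)))"
    using h lag_less by (intro sum.mono_neutral_right) auto
  also have "\<dots> = (\<Sum>j\<in>T. \<Sum>x\<in>{x \<in> {x :: 'p \<times> 'p. lag (fst x) (snd x) \<in> T}. lag (fst x) (snd x) = j}. h (lag (fst x) (snd x)))"
    using T' by (intro sum.group[symmetric]) auto
  also have "\<dots> = (\<Sum>j\<in>T. 2 * (real CARD('p) - real j) * h j)"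
  proof (rule sum.cong[OF refl])
    fix j assume j: "j \<in> T"
    then have "{x \<in> {x :: 'p \<times> 'p. lag (fst x) (snd x) \<in> T}. lag (fst x) (snd x) = j} = {(k, l). lag k l = j}"
      by auto
    moreover have "1 \<le> j" "j < CARD('p)" using j T by auto
    ultimately show "(\<Sum>x\<in>{x \<in> {x :: 'p \<times> 'p. lag (fst x) (snd x) \<in> T}. lag (fst x) (snd x) = j}. h (lag (fst x) (snd x)))
        = 2 * (real CARD('p) - real j) * h j"
      using card_lag_pairs[of j, where 'p='p]
        sum.cong[OF refl, of "{(k :: 'p, l). lag k l = j}" "\<lambda>x. h (lag (fst x) (snd x))" "\<lambda>_. h j"]
      by (simp add: of_nat_diff case_prod_beta)
  qed
  finally show ?thesis .
qed

text \<open>The multiplicity \<open>m\<close> is 2 for a full row; restricting the row to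
  \<open>N\<close> allows \<open>m = 1\<close> on the support of a column of
  \<open>signed_lag\<close> with two lags.\<close>

lemma sum_lag_row_le:
  fixes h :: "nat \<Rightarrow> real"
  assumes T: "finite T" and h: "\<And>i. i < CARD('p) \<Longrightarrow> i \<notin> T \<Longrightarrow> h i = 0" "\<And>i. h i \<ge> 0"
    and m: "\<And>j. j \<in> T \<Longrightarrow> card {l \<in> N. lag (k :: 'p::{finite,linorder}) l = j} \<le> m"
  shows "(\<Sum>l\<in>N. h (lag k l)) \<le> real m * (\<Sum>j\<in>T. h j)"
proof -
  have "(\<Sum>l\<in>N. h (lag k l)) = (\<Sum>l\<in>{l\<in>N. lag k l \<in> T}. h (lag k l))"
    using h(1) lag_less by (intro sum.mono_neutral_right) auto
  also have "\<dots> = (\<Sum>j\<in>T. \<Sum>l\<in>{l \<in> {l\<in>N. lag k l \<in> T}. lag k l = j}. h (lag k l))"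
    using T by (intro sum.group[symmetric]) auto
  also have "\<dots> = (\<Sum>j\<in>T. real (card {l \<in> N. lag k l = j}) * h j)"
    by (intro sum.cong refl) (auto intro!: arg_cong[of _ _ card])
  also have "\<dots> \<le> (\<Sum>j\<in>T. real m * h j)"
    using m h(2) by (intro sum_mono mult_right_mono) auto
  finally show ?thesis by (simp add: sum_distrib_left)
qed

lemma inner_matrix_sum:
  fixes H :: "real^'n^'n"
  shows "x \<bullet> (H *v x) = (\<Sum>k\<in>UNIV. \<Sum>l\<in>UNIV. x $ k * H $ k $ l * x $ l)"
  by (simp add: inner_vec_def matrix_vector_mult_def sum_distrib_left mult_ac)

lemma inner_matrix_vector_left:
  fixes A :: "real^'n^'m"
  shows "(A *v x) \<bullet> y = x \<bullet> (transpose A *v y)"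
  by (metis dot_lmul_matrix inner_commute transpose_matrix_vector)

text \<open>Schur's test: each product of two coordinates is at most half the sum of their squares,
  and symmetry merges the two halves. Only rows and columns in the support of \<open>x\<close>
  enter.\<close>

lemma abs_inner_matrix_le_row_sum:
  fixes H :: "real^'n^'n"
  assumes sym: "transpose H = H" and supp: "\<And>k. k \<notin> N \<Longrightarrow> x $ k = 0"
    and row: "\<And>k. k \<in> N \<Longrightarrow> (\<Sum>l\<in>N. \<bar>H $ k $ l\<bar>) \<le> r"
  shows "\<bar>x \<bullet> (H *v x)\<bar> \<le> r * (x \<bullet> x)"
proof -
  have symH: "H $ k $ l = H $ l $ k" for k l
    by (metis sym transpose_def vec_lambda_beta)
  have "x \<bullet> (H *v x) = (\<Sum>k\<in>N. \<Sum>l\<in>N. x $ k * H $ k $ l * x $ l)"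
    unfolding inner_matrix_sum
    by (intro sum.mono_neutral_cong_right sum.mono_neutral_right ballI) (auto simp: supp)
  then have "\<bar>x \<bullet> (H *v x)\<bar> \<le> (\<Sum>k\<in>N. \<Sum>l\<in>N. \<bar>x $ k * H $ k $ l * x $ l\<bar>)"
    by (auto intro!: order_trans[OF sum_abs] sum_mono)
  also have "\<dots> \<le> (\<Sum>k\<in>N. \<Sum>l\<in>N. \<bar>H $ k $ l\<bar> * (x $ k)\<^sup>2 / 2 + \<bar>H $ k $ l\<bar> * (x $ l)\<^sup>2 / 2)"
  proof (intro sum_mono)
    fix k l
    have "\<bar>x $ k\<bar> * \<bar>x $ l\<bar> \<le> ((x $ k)\<^sup>2 + (x $ l)\<^sup>2) / 2"
      using sum_squares_bound[of "\<bar>x $ k\<bar>" "\<bar>x $ l\<bar>"] by simp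
    from mult_left_mono[OF this, of "\<bar>H $ k $ l\<bar>"]
    show "\<bar>x $ k * H $ k $ l * x $ l\<bar> \<le> \<bar>H $ k $ l\<bar> * (x $ k)\<^sup>2 / 2 + \<bar>H $ k $ l\<bar> * (x $ l)\<^sup>2 / 2"
      by (simp add: abs_mult field_simps)
  qed
  also have "\<dots> = (\<Sum>k\<in>N. (x $ k)\<^sup>2 * (\<Sum>l\<in>N. \<bar>H $ k $ l\<bar>))"
  proof -
    have "(\<Sum>k\<in>N. \<Sum>l\<in>N. \<bar>H $ k $ l\<bar> * (x $ l)\<^sup>2 / 2) = (\<Sum>k\<in>N. \<Sum>l\<in>N. \<bar>H $ k $ l\<bar> * (x $ k)\<^sup>2 / 2)"
      by (subst sum.swap) (simp only: symH)
    moreover have "(\<Sum>k\<in>N. (x $ k)\<^sup>2 * (\<Sum>l\<in>N. \<bar>H $ k $ l\<bar>)) = 2 * (\<Sum>k\<in>N. \<Sum>l\<in>N. \<bar>H $ k $ l\<bar> * (x $ k)\<^sup>2 / 2)"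
      by (simp add: sum_distrib_left mult_ac)
    ultimately show ?thesis by (simp add: sum.distrib)
  qed
  also have "\<dots> \<le> (\<Sum>k\<in>N. (x $ k)\<^sup>2 * r)"
    using row by (intro sum_mono mult_left_mono) auto
  also have "\<dots> = r * (x \<bullet> x)"
  proof -
    have "(\<Sum>k\<in>N. (x $ k)\<^sup>2) = x \<bullet> x"
      unfolding inner_vec_def by (intro sum.mono_neutral_cong_left) (auto simp: supp power2_eq_square)
    then show ?thesis by (metis mult.commute sum_distrib_right)
  qed
  finally show ?thesis .
qed

lemma transpose_lag_toeplitz [simp]: "transpose (lag_toeplitz f) = lag_toeplitz f"
  by (simp add: vec_eq_iff transpose_def lag_commute)

lemma abs_inner_lag_toeplitz_le:
  fixes x :: "real^'p::{finite,linorder}"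
  assumes "finite T" "\<And>i. i < CARD('p) \<Longrightarrow> i \<notin> T \<Longrightarrow> f i = 0"
  shows "\<bar>x \<bullet> (lag_toeplitz f *v x)\<bar> \<le> 2 * (\<Sum>j\<in>T. \<bar>f j\<bar>) * (x \<bullet> x)"
proof (rule abs_inner_matrix_le_row_sum[where N=UNIV])
  fix k :: 'p
  show "(\<Sum>l\<in>UNIV. \<bar>lag_toeplitz f $ k $ l\<bar>) \<le> 2 * (\<Sum>j\<in>T. \<bar>f j\<bar>)"
    using sum_lag_row_le[of T "\<lambda>i. \<bar>f i\<bar>" UNIV k 2] assms by (simp add: card_lag_le)
qed auto

lemma trace_lag_toeplitz_mult:
  assumes "T \<subseteq> {1..<CARD('p::{finite,linorder})}"
    and "\<And>i. i < CARD('p) \<Longrightarrow> i \<notin> T \<Longrightarrow> f i = 0"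
  shows "trace (lag_toeplitz f ** lag_toeplitz g :: real^'p::{finite,linorder}^'p::{finite,linorder}) = (\<Sum>j\<in>T. 2 * (real CARD('p) - real j) * (f j * g j))"
proof -
  have "trace (lag_toeplitz f ** lag_toeplitz g :: real^'p::{finite,linorder}^'p::{finite,linorder}) = (\<Sum>k\<in>UNIV. \<Sum>l\<in>UNIV. f (lag (k::'p) l) * g (lag k l))"
    by (simp add: trace_def matrix_matrix_mult_def) (simp add: lag_commute)
  then show ?thesis
    using sum_lag_pairs[OF assms(1), of "\<lambda>i. f i * g i"] assms(2) by simp
qed

text \<open>The trace is the sum of the quadratic forms at the columns of \<open>Y\<close>, so a
  bound at these vectors suffices.\<close>

lemma trace_congruence_le:
  fixes S Y :: "real^'n^'n"
  assumes "\<And>i. column i Y \<bullet> (S *v column i Y) \<le> K * (column i Y \<bullet> column i Y)"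
  shows "trace (transpose Y ** S ** Y) \<le> K * trace (transpose Y ** Y)"
proof -
  have *: "trace (transpose Y ** C ** Y) = (\<Sum>i\<in>UNIV. column i Y \<bullet> (C *v column i Y))" for C
    by (simp add: trace_def matrix_mul_assoc[symmetric])
       (simp add: matrix_matrix_mult_def transpose_def inner_vec_def column_def matrix_vector_mult_def)
  from assms show ?thesis
    using *[of S] *[of "mat 1"] by (simp add: sum_distrib_left sum_mono)
qed

text \<open>The sum of squares is the trace of \<open>B ** \<Sigma> ** B ** \<Sigma>\<close>. One
  factor \<Sigma> is bounded by \<open>K\<close>; cyclicity then brings the other one between two
  copies of \<open>B\<close>, where it acts on the columns of \<open>B\<close> and costs
  \<open>K'\<close>. For the last claim, \<open>\<mu> i\<close> is the form of \<open>B\<close> at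
  \<open>y = M *v axis i 1\<close>.\<close>

lemma simultaneous_diagonalization_bounds:
  fixes \<Sigma> B M :: "real^'n^'n"
  assumes M: "M ** transpose M = \<Sigma>" and \<mu>: "transpose M ** B ** M = diag_mat \<mu>" and B: "transpose B = B"
    and K: "\<And>x. x \<bullet> (\<Sigma> *v x) \<le> K * (x \<bullet> x)" and L: "\<And>x. \<bar>x \<bullet> (B *v x)\<bar> \<le> L * (x \<bullet> x)"
    and K': "\<And>i. column i B \<bullet> (\<Sigma> *v column i B) \<le> K' * (column i B \<bullet> column i B)"
    and K_nonneg: "K \<ge> 0" and L_nonneg: "L \<ge> 0"
  shows "sum \<mu> UNIV = trace (B ** \<Sigma>)"
    and "(\<Sum>i\<in>UNIV. (\<mu> i)\<^sup>2) \<le> K * K' * trace (B ** B)"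
    and "- (L * K) \<le> \<mu> i"
proof -
  have "sum \<mu> UNIV = trace (transpose M ** (B ** M))" by (simp flip: \<mu> trace_diag_mat add: matrix_mul_assoc)
  also have "\<dots> = trace (B ** (M ** transpose M))"
    by (subst trace_mul_sym) (simp add: matrix_mul_assoc)
  finally show "sum \<mu> UNIV = trace (B ** \<Sigma>)" by (simp add: M)
  have "(\<Sum>i\<in>UNIV. (\<mu> i)\<^sup>2) = trace (diag_mat \<mu> ** diag_mat \<mu>)"
    by (simp add: diag_mat_mult power2_eq_square)
  also have "diag_mat \<mu> ** diag_mat \<mu> = transpose (B ** M) ** \<Sigma> ** (B ** M)"
    by (simp flip: \<mu> M add: matrix_transpose_mul B matrix_mul_assoc)
  also have "trace \<dots> \<le> K * trace (transpose (B ** M) ** (B ** M))"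
    by (intro trace_congruence_le K)
  also have "trace (transpose (B ** M) ** (B ** M)) = trace (transpose M ** (B ** B ** M))"
    by (simp add: matrix_transpose_mul B matrix_mul_assoc)
  also have "\<dots> = trace (B ** (B ** \<Sigma>))"
    by (subst trace_mul_sym) (simp flip: M add: matrix_mul_assoc)
  also have "\<dots> = trace (transpose B ** \<Sigma> ** B)"
    by (subst trace_mul_sym) (simp add: B matrix_mul_assoc)
  also have "\<dots> \<le> K' * trace (transpose B ** B)"
    by (intro trace_congruence_le K')
  finally show "(\<Sum>i\<in>UNIV. (\<mu> i)\<^sup>2) \<le> K * K' * trace (B ** B)"
    using K_nonneg by (simp add: B mult_left_mono mult.assoc)
  define y where "y = M *v axis i 1"
  \<comment> \<open>Cauchy-Schwarz bounds \<open>(y \<bullet> y)\<^sup>2\<close> by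
    \<open>y \<bullet> (\<Sigma> *v y)\<close>, hence by \<open>K * (y \<bullet> y)\<close>; so the
    squared norm of \<open>y\<close> is at most \<open>K\<close>.\<close>
  have "y \<bullet> y = axis i 1 \<bullet> (transpose M *v y)"
    unfolding y_def by (simp add: inner_matrix_vector_left[of M])
  also have "\<dots> \<le> norm (transpose M *v y)"
    using norm_cauchy_schwarz[of "axis i 1" "transpose M *v y"] by simp
  finally have "(y \<bullet> y)\<^sup>2 \<le> (norm (transpose M *v y))\<^sup>2"
    by (intro power_mono) auto
  also have "\<dots> = (transpose M *v y) \<bullet> (transpose M *v y)" by (simp add: power2_norm_eq_inner)
  also have "\<dots> = y \<bullet> (\<Sigma> *v y)"
    using inner_matrix_vector_left[of "transpose M" y "transpose M *v y"]
    by (simp only: M[symmetric] matrix_vector_mul_assoc transpose_transpose)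
  also have "\<dots> \<le> K * (y \<bullet> y)" by (rule K)
  finally have "(y \<bullet> y) * (y \<bullet> y) \<le> K * (y \<bullet> y)" by (simp add: power2_eq_square)
  then have yK: "y \<bullet> y \<le> K"
    using K_nonneg by (cases "y = 0") (auto simp: mult_le_cancel_right)
  have "\<mu> i = axis i 1 \<bullet> (diag_mat \<mu> *v axis i 1)"
    by (simp add: inner_diag_mat axis_def if_distrib[of "\<lambda>x. x ^ 2"] if_distrib[of "\<lambda>x. _ * x"] cong: if_cong)
  also have "\<dots> = y \<bullet> (B *v y)" by (simp flip: \<mu> add: inner_matrix_congruence y_def)
  finally have "\<bar>\<mu> i\<bar> \<le> L * (y \<bullet> y)" using L by simp
  also have "\<dots> \<le> L * K" using yK L_nonneg by (rule mult_left_mono)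
  finally show "- (L * K) \<le> \<mu> i" by linarith
qed

section \<open>Tails of the lag statistics\<close>


lemma lag_self [simp]: "lag k k = 0"
  by simp

lemma mat_1_eq_lag_toeplitz: "mat 1 = lag_toeplitz (\<lambda>i. if i = 0 then 1 else 0)"
  by (simp add: vec_eq_iff mat_def)

text \<open>The matrix \<open>\<Sum>\<^sub>j \<epsilon>\<^sub>j A\<^sub>j\<close> over \<open>j \<in> T\<close>.\<close>

definition signed_lag :: "nat set \<Rightarrow> (nat \<Rightarrow> real) \<Rightarrow> real^'p::{finite,linorder}^'p::{finite,linorder}" where
  "signed_lag T \<epsilon> = lag_toeplitz (\<lambda>i. if i \<in> T then \<epsilon> i / (2 * (real CARD('p) - real i)) else 0)"

lemma transpose_signed_lag [simp]: "transpose (signed_lag T \<epsilon>) = signed_lag T \<epsilon>"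
  by (simp add: signed_lag_def)

lemma phi_sample_cov:
  "phi B (sample_cov n X) = (\<Sum>k=1..n. X k \<bullet> (B *v X k)) / real n"
proof -
  have "phi B (sample_cov n X) = (\<Sum>i\<in>UNIV. \<Sum>l\<in>UNIV. (\<Sum>k=1..n. X k $ i * B $ i $ l * X k $ l) / real n)"
    by (simp add: phi_def trace_def matrix_matrix_mult_def sample_cov_nth sum_distrib_left mult_ac)
  also have "\<dots> = (\<Sum>i\<in>UNIV. \<Sum>k=1..n. \<Sum>l\<in>UNIV. X k $ i * B $ i $ l * X k $ l) / real n"
    unfolding sum_divide_distrib[symmetric]
    by (rule arg_cong[where f="\<lambda>x. x / real n"], rule sum.cong[OF refl], rule sum.swap)
  also have "\<dots> = (\<Sum>k=1..n. X k \<bullet> (B *v X k)) / real n"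
    unfolding inner_matrix_sum by (rule arg_cong[where f="\<lambda>x. x / real n"], rule sum.swap)
  finally show ?thesis .
qed

lemma phi_A_mat_mat_1:
  assumes "j \<ge> 1"
  shows "phi (A_mat j) (mat 1 :: real^'p::{finite,linorder}^'p::{finite,linorder}) = 0"
  using assms by (simp add: phi_def trace_def A_mat_def)

lemma sum_phi_A_mat:
  fixes Y :: "real^'p::{finite,linorder}^'p::{finite,linorder}"
  assumes "finite T"
  shows "(\<Sum>j\<in>T. \<epsilon> j * phi (A_mat j) Y) = phi (signed_lag T \<epsilon>) Y"
proof -
  have *: "(\<Sum>j\<in>T. \<epsilon> j * A_mat j $ k $ l) = signed_lag T \<epsilon> $ k $ l" for k l :: 'p
    using assms by (simp add: A_mat_def signed_lag_def if_distrib[of "\<lambda>x. _ * x"] cong: if_cong)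
  have "(\<Sum>j\<in>T. \<epsilon> j * phi (A_mat j) Y) = (\<Sum>j\<in>T. \<Sum>k\<in>UNIV. \<Sum>l\<in>UNIV. \<epsilon> j * A_mat j $ k $ l * Y $ l $ k)"
    by (simp add: phi_def trace_def matrix_matrix_mult_def sum_distrib_left mult.assoc)
  also have "\<dots> = (\<Sum>k\<in>UNIV. \<Sum>l\<in>UNIV. \<Sum>j\<in>T. \<epsilon> j * A_mat j $ k $ l * Y $ l $ k)"
    by (subst sum.swap, rule sum.cong[OF refl], rule sum.swap)
  also have "\<dots> = phi (signed_lag T \<epsilon>) Y"
    by (simp add: * sum_distrib_right[symmetric] phi_def trace_def matrix_matrix_mult_def)
  finally show ?thesis .
qed

text \<open>Turns the signed statistic into an average of Gaussian quadratic forms; the centering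
  drops out because \<open>A_mat j\<close> has zero diagonal for \<open>j \<ge> 1\<close>.\<close>

lemma sum_phi_A_mat_sample_cov:
  fixes X :: "nat \<Rightarrow> real^'p::{finite,linorder}"
  assumes "T \<subseteq> {1..S}"
  shows "(\<Sum>j\<in>T. \<epsilon> j * phi (A_mat j) (sample_cov n X - mat 1)) =
    (\<Sum>k=1..n. X k \<bullet> (signed_lag T \<epsilon> *v X k)) / real n"
proof -
  have fin: "finite T" using assms finite_subset by blast
  have "phi (A_mat j) (sample_cov n X - mat 1) = phi (A_mat j) (sample_cov n X)" if "j \<in> T" for j
  proof -
    have "phi (A_mat j) (Y - Z) = phi (A_mat j) Y - phi (A_mat j) Z" for Y Z :: "real^'p::{finite,linorder}^'p::{finite,linorder}"
      by (simp add: phi_def trace_def matrix_matrix_mult_def right_diff_distrib sum_subtractf)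
    moreover have "j \<ge> 1" using that assms by auto
    ultimately show ?thesis by (simp add: phi_A_mat_mat_1)
  qed
  then have "(\<Sum>j\<in>T. \<epsilon> j * phi (A_mat j) (sample_cov n X - mat 1)) = (\<Sum>j\<in>T. \<epsilon> j * phi (A_mat j) (sample_cov n X))"
    by simp
  then show ?thesis unfolding sum_phi_A_mat[OF fin] unfolding phi_sample_cov .
qed

text \<open>This is the mean of the signed statistic under the covariance
  \<open>lag_toeplitz c\<close>: the number of entries at lag \<open>j\<close> cancels the
  normalization of \<open>A_mat j\<close>.\<close>

lemma trace_signed_lag_mult:
  assumes "T \<subseteq> {1..<CARD('p::{finite,linorder})}"
  shows "trace (signed_lag T \<epsilon> ** lag_toeplitz c :: real^'p::{finite,linorder}^'p::{finite,linorder}) = (\<Sum>j\<in>T. \<epsilon> j * c j)"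
  unfolding signed_lag_def
  by (subst trace_lag_toeplitz_mult[OF assms]) (use assms in \<open>auto intro!: sum.cong\<close>)

lemma trace_signed_lag_square:
  assumes "T \<subseteq> {1..S}" "S < CARD('p::{finite,linorder})" "\<And>j. j \<in> T \<Longrightarrow> \<bar>\<epsilon> j\<bar> \<le> 1"
  shows "trace (signed_lag T \<epsilon> ** signed_lag T \<epsilon> :: real^'p::{finite,linorder}^'p::{finite,linorder})
    \<le> real (card T) / (2 * (real CARD('p) - real S))"
proof -
  have T: "T \<subseteq> {1..<CARD('p)}" using assms by auto
  have "trace (signed_lag T \<epsilon> ** signed_lag T \<epsilon> :: real^'p::{finite,linorder}^'p::{finite,linorder})
      = (\<Sum>j\<in>T. (\<epsilon> j)\<^sup>2 / (2 * (real CARD('p) - real j)))"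
    unfolding signed_lag_def[of T \<epsilon>, where 'p='p]
    by (subst trace_signed_lag_mult[OF T, of \<epsilon>, unfolded signed_lag_def])
      (auto intro!: sum.cong simp: power2_eq_square)
  also have "\<dots> \<le> (\<Sum>j\<in>T. 1 / (2 * (real CARD('p) - real S)))"
    using assms by (intro sum_mono frac_le) (auto simp: abs_square_le_1)
  finally show ?thesis by simp
qed

lemma abs_inner_signed_lag_le:
  fixes x :: "real^'p::{finite,linorder}"
  assumes "T \<subseteq> {1..S}" "S < CARD('p)" "\<And>j. j \<in> T \<Longrightarrow> \<bar>\<epsilon> j\<bar> \<le> 1"
  shows "\<bar>x \<bullet> (signed_lag T \<epsilon> *v x)\<bar> \<le> real (card T) / (real CARD('p) - real S) * (x \<bullet> x)"
proof -
  have fin: "finite T" using assms finite_subset by blast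
  have half_cancel: "2 * (a * (1 / (2 * b))) = a / b" for a b :: real by simp
  let ?f = "\<lambda>i. if i \<in> T then \<epsilon> i / (2 * (real CARD('p) - real i)) else 0"
  have "\<bar>x \<bullet> (signed_lag T \<epsilon> *v x)\<bar> \<le> 2 * (\<Sum>j\<in>T. \<bar>?f j\<bar>) * (x \<bullet> x)"
    unfolding signed_lag_def using fin by (intro abs_inner_lag_toeplitz_le) auto
  also have "(\<Sum>j\<in>T. \<bar>?f j\<bar>) \<le> (\<Sum>j\<in>T. 1 / (2 * (real CARD('p) - real S)))"
  proof (rule sum_mono)
    fix j assume j: "j \<in> T"
    then have "real j \<le> real S" "real S < real CARD('p)" using assms by auto
    then show "\<bar>?f j\<bar> \<le> 1 / (2 * (real CARD('p) - real S))"
      using j assms(3)[OF j] by (auto simp: abs_mult intro!: frac_le)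
  qed
  then have "2 * (\<Sum>j\<in>T. \<bar>?f j\<bar>) * (x \<bullet> x) \<le> 2 * (\<Sum>j\<in>T. 1 / (2 * (real CARD('p) - real S))) * (x \<bullet> x)"
    by (intro mult_right_mono) auto
  also have "2 * (\<Sum>j\<in>T. 1 / (2 * (real CARD('p) - real S))) = real (card T) / (real CARD('p) - real S)"
    unfolding sum_constant by (rule half_cancel)
  finally show ?thesis .
qed

text \<open>\<open>gaussian_form_lower_tail\<close> with variance proxy
  \<open>K * K' * card T / (2 * (p - S))\<close> and lower spectral bound
  \<open>card T * K / (p - S)\<close>, where \<open>p = CARD('p)\<close>. The rescaled
  \<open>x\<close> absorbs \<open>n\<close> and \<open>p - S\<close>.\<close>

lemma signed_lag_lower_tail:
  fixes \<Sigma> :: "real^'p::{finite,linorder}^'p::{finite,linorder}"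
  assumes \<Sigma>: "\<Sigma> \<in> sym_pos_def" "\<Sigma> = lag_toeplitz c"
    and T: "T \<subseteq> {1..S}" "S < CARD('p)" "T \<noteq> {}" and \<epsilon>: "\<And>j. j \<in> T \<Longrightarrow> \<bar>\<epsilon> j\<bar> \<le> 1"
    and K: "\<And>x. x \<bullet> (\<Sigma> *v x) \<le> K * (x \<bullet> x)" "K > 0"
    and K': "\<And>i. column i (signed_lag T \<epsilon>) \<bullet> (\<Sigma> *v column i (signed_lag T \<epsilon>)) \<le>
      K' * (column i (signed_lag T \<epsilon>) \<bullet> column i (signed_lag T \<epsilon>))" "K' > 0"
    and n: "n \<ge> 1" and z: "z \<ge> 0" and x: "x = sqrt (z / (n * (real CARD('p) - real S)))"
    and \<delta>: "\<delta> \<ge> sqrt (2 * real (card T) * K * K') * x + 2 * real (card T) * K * x\<^sup>2"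
  shows "\<P>(X in iid_gaussian n \<Sigma>. (\<Sum>j\<in>T. \<epsilon> j * phi (A_mat j) (sample_cov n X - mat 1)) \<le> (\<Sum>j\<in>T. \<epsilon> j * c j) - \<delta>) \<le> exp (- z)"
proof -
  let ?B = "signed_lag T \<epsilon> :: real^'p::{finite,linorder}^'p::{finite,linorder}"
  define N where "N = real CARD('p) - real S"
  have N: "N > 0" using T by (simp add: N_def)
  have T0: "card T > 0" using T finite_subset by (auto simp: card_gt_0_iff)
  obtain M :: "real^'p::{finite,linorder}^'p::{finite,linorder}" and \<mu> where M: "M ** transpose M = \<Sigma>" "transpose M ** ?B ** M = diag_mat \<mu>"
    using sym_pos_def_simultaneous_diagonalization[OF \<Sigma>(1) transpose_signed_lag] by blast
  define L where "L = real (card T) / N"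
  have L: "L \<ge> 0" using N by (simp add: L_def)
  have Lx: "\<bar>x \<bullet> (?B *v x)\<bar> \<le> L * (x \<bullet> x)" for x
    unfolding L_def N_def by (rule abs_inner_signed_lag_le[OF T(1,2) \<epsilon>])
  note bounds = simultaneous_diagonalization_bounds[OF M transpose_signed_lag K(1) Lx K'(1) less_imp_le[OF K(2)] L]
  have tr: "trace (?B ** \<Sigma>) = (\<Sum>j\<in>T. \<epsilon> j * c j)"
    unfolding \<Sigma>(2) using T by (intro trace_signed_lag_mult) auto
  define v where "v = K * K' * (real (card T) / (2 * N))"
  have v: "v > 0" using K K' T0 N by (simp add: v_def)
  have sq: "(\<Sum>i\<in>UNIV. (\<mu> i)\<^sup>2) \<le> v"
  proof -
    have "trace (?B ** ?B) \<le> real (card T) / (2 * N)"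
      unfolding N_def by (rule trace_signed_lag_square[OF T(1,2) \<epsilon>])
    then have "K * K' * trace (?B ** ?B) \<le> v"
      unfolding v_def using K(2) K'(2) by (intro mult_left_mono) auto
    with bounds(2) show ?thesis by linarith
  qed
  have x2: "x\<^sup>2 = z / n / N" using z N by (simp add: x N_def)
  have x0: "x \<ge> 0" using z N by (simp add: x N_def)
  have "2 * sqrt (v * (z / n)) = sqrt (4 * (v * (z / n)))" unfolding real_sqrt_mult[of 4] by simp
  also have "4 * (v * (z / n)) = (2 * real (card T) * K * K') * x\<^sup>2"
    using N by (simp add: x2 v_def field_simps)
  finally have *: "2 * sqrt (v * (z / n)) = sqrt (2 * real (card T) * K * K') * x"
    using x0 by (simp add: real_sqrt_mult)
  have lin: "2 * (L * K) * (z / n) = 2 * real (card T) * K * x\<^sup>2"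
    using N by (simp add: x2 L_def field_simps)
  have "2 * sqrt (v * (z / n)) + 2 * (L * K) * (z / n) \<le> \<delta>"
    unfolding * lin by (rule \<delta>)
  note tail = gaussian_form_lower_tail[OF \<Sigma>(1) transpose_signed_lag M n z v sq _ bounds(3) this]
  have "\<P>(X in iid_gaussian n \<Sigma>. (\<Sum>j\<in>T. \<epsilon> j * phi (A_mat j) (sample_cov n X - mat 1)) \<le> (\<Sum>j\<in>T. \<epsilon> j * c j) - \<delta>)
    = \<P>(X in iid_gaussian n \<Sigma>. (\<Sum>k=1..n. X k \<bullet> (?B *v X k)) \<le> n * (sum \<mu> UNIV - \<delta>))"
    using n by (simp add: sum_phi_A_mat_sample_cov[OF T(1)] bounds(1) tr field_simps)
  also have "\<dots> \<le> exp (- z)" by (rule tail) (use L K in auto)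
  finally show ?thesis .
qed

text \<open>Under the identity covariance \<open>K = K' = 1\<close>, so the deviation to be covered
  is \<open>sqrt 2 * x + 2 * x\<^sup>2\<close>. The two terms of the maximum cross at
  \<open>x = 1 / 4\<close>, and on either side the larger one dominates
  \<open>3 / 2 * x + 2 * x\<^sup>2\<close>.\<close>

lemma phi_A_mat_null_tail:
  fixes n S j :: nat
  assumes j: "j \<in> {1..S}" and S: "S < CARD('p::{finite,linorder})" and n: "n \<ge> 1" and z: "z \<ge> 0"
    and x: "x = sqrt (z / (n * (real CARD('p) - real S)))" and \<tau>: "\<tau> \<ge> max (2 * x) (8 * x\<^sup>2)"
    and \<epsilon>: "\<bar>\<epsilon>\<bar> \<le> 1"
  shows "\<P>(X in iid_gaussian n (mat 1 :: real^'p::{finite,linorder}^'p::{finite,linorder}).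
    \<epsilon> * phi (A_mat j) (sample_cov n X - mat 1) \<le> - \<tau>) \<le> exp (- z)"
proof -
  have pd: "(mat 1 :: real^'p::{finite,linorder}^'p::{finite,linorder}) \<in> sym_pos_def"
    by (auto simp: sym_pos_def_def)
  have x0: "x \<ge> 0" using z S by (simp add: x)
  have "sqrt 2 \<le> 3 / 2" by (rule real_le_lsqrt) (auto simp: power2_eq_square)
  then have "sqrt 2 * x + 2 * x\<^sup>2 \<le> 3 / 2 * x + 2 * x\<^sup>2"
    using mult_right_mono[OF _ x0, of "sqrt 2" "3 / 2"] by simp
  also have "\<dots> \<le> max (2 * x) (8 * x\<^sup>2)"
  proof (cases "x \<le> 1 / 4")
    case True
    then have "x * x \<le> 1 / 4 * x" using x0 by (intro mult_right_mono)
    then show ?thesis by (simp add: power2_eq_square max_def)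
  next
    case False
    then have "x * x \<ge> 1 / 4 * x" using x0 by (intro mult_right_mono) auto
    then show ?thesis by (simp add: power2_eq_square max_def)
  qed
  also note \<tau>
  finally have "sqrt 2 * x + 2 * x\<^sup>2 \<le> \<tau>" .
  then show ?thesis
    using signed_lag_lower_tail[OF pd mat_1_eq_lag_toeplitz, of "{j}" S "\<lambda>_. \<epsilon>" 1 1 n z x \<tau>] assms
    by simp
qed


section \<open>Second kind error for a single lag\<close>

text \<open>
  With \<open>h = \<sigma> g\<close> for an eigenvalue \<open>g\<close> of the single-lag matrix \<open>G\<close>, the subtracted term is a multiple of
  \<open>g\<^sup>2 + \<sigma> g\<^sup>3\<close>, and the cubes sum to 0. It exceeds \<open>w\<^sup>2 / 2\<close>, where \<open>w = k h (1 + h)\<close>, by the factor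
  \<open>2 / (1 + h)\<close>, which for \<open>h < 0\<close> pays for the failure of \<open>ln (1 + w) \<ge> w - w\<^sup>2 / 2\<close>.
\<close>

lemma ln_one_plus_lower_bound_cubic:
  fixes h k :: real
  assumes h: "\<bar>h\<bar> \<le> 1" and k: "0 \<le> k" "k \<le> 1 / 4"
  shows "k * h * (1 + h) - k\<^sup>2 * h\<^sup>2 * (1 + h) \<le> ln (1 + k * h * (1 + h))" and "k * h * (1 + h) > - 1"
proof -
  define w where "w = k * h * (1 + h)"
  have "h * (1 + h) \<ge> - 1 / 4"
    using zero_le_power2[of "h + 1 / 2"] by (simp add: power2_eq_square algebra_simps)
  from mult_left_mono[OF this k(1)] have w: "w \<ge> - 1 / 16"
    using k by (simp add: w_def mult_ac)
  then show "k * h * (1 + h) > - 1" by (simp add: w_def)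
  \<comment> \<open>For \<open>h \<ge> 0\<close> the plain bound with \<beta> = 0 works since
    \<open>1 + h \<le> 2\<close>; for \<open>h < 0\<close> the minimum \<open>- 1 / 4\<close> of
    \<open>h * (1 + h)\<close> and \<open>k \<le> 1 / 4\<close> give
    \<open>w \<ge> - 1 / 16\<close>.\<close>
  define \<beta> :: real where "\<beta> = (if h \<ge> 0 then 0 else 1 / 16)"
  have "- \<beta> \<le> w" using w h k by (auto simp: \<beta>_def w_def)
  then have "w - w\<^sup>2 / (2 * (1 - \<beta>)) \<le> ln (1 + w)"
    by (intro ln_one_plus_quadratic_lower_bound) (auto simp: \<beta>_def)
  moreover have "w\<^sup>2 / (2 * (1 - \<beta>)) \<le> k\<^sup>2 * h\<^sup>2 * (1 + h)"
  proof -
    have "(1 + h) / (2 * (1 - \<beta>)) \<le> 1" using h by (auto simp: \<beta>_def)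
    then have "k\<^sup>2 * h\<^sup>2 * (1 + h) * ((1 + h) / (2 * (1 - \<beta>))) \<le> k\<^sup>2 * h\<^sup>2 * (1 + h) * 1"
      using h by (intro mult_left_mono) auto
    then show ?thesis by (simp add: w_def power_mult_distrib power2_eq_square mult_ac)
  qed
  ultimately show "k * h * (1 + h) - k\<^sup>2 * h\<^sup>2 * (1 + h) \<le> ln (1 + k * h * (1 + h))"
    by (simp add: w_def)
qed

lemma sum_diag_mat_conjugate:
  fixes U G :: "real^'n^'n"
  assumes U: "orthogonal_matrix U" "transpose U ** G ** U = diag_mat g"
  shows "sum g UNIV = trace G" "(\<Sum>i\<in>UNIV. (g i)\<^sup>2) = trace (G ** G)" "(\<Sum>i\<in>UNIV. (g i) ^ 3) = trace (G ** (G ** G))"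
proof -
  have UU: "U ** transpose U = mat 1" using U(1) by (simp add: orthogonal_matrix_def)
  have conj: "trace (transpose U ** C ** U) = trace C" for C
    using trace_mul_sym[of "transpose U ** C" U] by (simp add: matrix_mul_assoc UU)
  show "sum g UNIV = trace G" by (simp flip: conj[of G] add: U(2))
  have mul: "(transpose U ** C ** U) ** (transpose U ** C' ** U) = transpose U ** (C ** C') ** U" for C C'
  proof -
    have "(transpose U ** C ** U) ** (transpose U ** C' ** U) = transpose U ** C ** (U ** transpose U) ** C' ** U"
      by (simp add: matrix_mul_assoc)
    then show ?thesis by (simp add: UU matrix_mul_assoc)
  qed
  have 2: "transpose U ** (G ** G) ** U = diag_mat (\<lambda>i. (g i)\<^sup>2)"
    by (simp flip: mul add: U(2) diag_mat_mult power2_eq_square)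
  then show "(\<Sum>i\<in>UNIV. (g i)\<^sup>2) = trace (G ** G)" by (simp flip: conj[of "G ** G"])
  have "transpose U ** (G ** (G ** G)) ** U = diag_mat (\<lambda>i. (g i) ^ 3)"
    using mul[of G "G ** G"] by (simp add: U(2) 2 diag_mat_mult power3_eq_cube power2_eq_square mult_ac)
  then show "(\<Sum>i\<in>UNIV. (g i) ^ 3) = trace (G ** (G ** G))" by (simp flip: conj[of "G ** (G ** G)"])
qed

text \<open>Conjugation by the signs \<open>(-1)\<^bsup>pos k div j\<^esup>\<close> negates a Toeplitz matrix supported on lag \<open>j\<close>.\<close>

lemma single_lag_negate:
  fixes x :: "real^'p::{finite,linorder}"
  assumes j: "j \<ge> 1" and f: "\<And>i. i \<noteq> j \<Longrightarrow> f i = 0"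
  obtains y :: "real^'p::{finite,linorder}" where "y \<bullet> y = x \<bullet> x" "y \<bullet> (lag_toeplitz f *v y) = - (x \<bullet> (lag_toeplitz f *v x))"
proof -
  define d where "d k = (- 1 :: real) ^ (pos k div j)" for k :: 'p
  have dd: "d k * d k = 1" for k by (simp add: d_def flip: power_add)
  have neg: "d k * d l = - 1" if "lag k l = j" for k l
  proof -
    have "pos k = pos l + j \<or> pos l = pos k + j" using that by (auto simp: lag_def)
    then have "pos k div j = Suc (pos l div j) \<or> pos l div j = Suc (pos k div j)"
      using j by (auto simp: div_add_self2)
    then show ?thesis using dd by (auto simp: d_def)
  qed
  define y where "y = (\<chi> k. d k * x $ k)"
  have "y \<bullet> y = (\<Sum>k\<in>UNIV. (d k * d k) * (x $ k * x $ k))"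
    by (simp add: inner_vec_def y_def mult_ac)
  then have "y \<bullet> y = x \<bullet> x" by (simp add: dd inner_vec_def)
  moreover have "y $ k * lag_toeplitz f $ k $ l * y $ l = - (x $ k * lag_toeplitz f $ k $ l * x $ l)" for k l
  proof (cases "lag k l = j")
    case True
    have "y $ k * lag_toeplitz f $ k $ l * y $ l = (d k * d l) * (x $ k * lag_toeplitz f $ k $ l * x $ l)"
      by (simp add: y_def mult_ac)
    then show ?thesis using neg[OF True] by simp
  next
    case False then show ?thesis by (simp add: f)
  qed
  then have "y \<bullet> (lag_toeplitz f *v y) = - (x \<bullet> (lag_toeplitz f *v x))"
    by (simp only: inner_matrix_sum sum_negf)
  ultimately show ?thesis using that by blast
qed

text \<open>A nonzero term would be a closed walk of three steps \<open>\<plusminus>j\<close>, whose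
  sum is an odd multiple of \<open>j\<close> and hence not 0.\<close>

lemma trace_single_lag_cube:
  assumes j: "j \<ge> 1" and f: "\<And>i. i \<noteq> j \<Longrightarrow> f i = 0"
  shows "trace (lag_toeplitz f ** (lag_toeplitz f ** lag_toeplitz f) :: real^'p::{finite,linorder}^'p::{finite,linorder}) = 0"
proof -
  have zero: "f (lag i k) * (f (lag k l) * f (lag l i)) = 0" for i k l :: 'p
  proof (rule ccontr)
    assume "\<not> ?thesis"
    then have "lag i k = j" "lag k l = j" "lag l i = j" using f by force+
    then show False using j by (auto simp: lag_def abs_if split: if_splits)
  qed
  then show ?thesis
    by (simp add: trace_def matrix_matrix_mult_def sum_distrib_left zero del: mult_eq_0_iff)
qed

text \<open>Here \<Sigma> = I + \<sigma>G and \<open>B\<close> is a multiple of \<open>G\<close>, so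
  one orthogonal \<open>U\<close> diagonalizes both and the eigenvalues of
  \<open>B ** \<Sigma>\<close> are explicit in those of \<open>G\<close>. Their first and third
  power sums vanish, and the second is \<open>2 * q\<close>, which makes the bound from
  \<open>ln_one_plus_lower_bound_cubic\<close> exactly computable.\<close>

lemma single_lag_lower_tail:
  fixes \<Sigma> :: "real^'p::{finite,linorder}^'p::{finite,linorder}"
  assumes \<Sigma>: "\<Sigma> \<in> sym_pos_def" "\<Sigma> = lag_toeplitz c" and c: "c 0 = 1" "\<And>i. 1 \<le> i \<Longrightarrow> i < CARD('p) \<Longrightarrow> i \<noteq> j \<Longrightarrow> c i = 0"
    and j: "1 \<le> j" "j < CARD('p)" and \<epsilon>: "\<epsilon> * c j = \<bar>c j\<bar>" "\<epsilon>\<^sup>2 = 1"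
    and n: "n \<ge> 1" and z: "z \<ge> 0" and y: "y = sqrt (z / (n * (real CARD('p) - real j)))"
    and cj: "c j \<noteq> 0" "4 * y \<le> \<bar>c j\<bar>" and \<delta>: "\<delta> \<ge> 2 * y"
  shows "\<P>(X in iid_gaussian n \<Sigma>. \<epsilon> * phi (A_mat j) (sample_cov n X - mat 1) \<le> \<bar>c j\<bar> - \<delta>) \<le> exp (- z)"
proof -
  define q where "q = real CARD('p) - real j"
  define \<sigma> where "\<sigma> = \<bar>c j\<bar>"
  have q: "q > 0" using j by (simp add: q_def)
  have \<sigma>: "\<sigma> > 0" using cj by (simp add: \<sigma>_def)
  have y0: "y \<ge> 0" and y2: "y\<^sup>2 = z / (n * q)" using z q by (simp_all add: y q_def)
  let ?f = "\<lambda>i. if i = j then \<epsilon> else 0"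
  define G where "G = (lag_toeplitz ?f :: real^'p::{finite,linorder}^'p::{finite,linorder})"
  let ?B = "signed_lag {j} (\<lambda>_. \<epsilon>) :: real^'p::{finite,linorder}^'p::{finite,linorder}"
  have B: "?B = (1 / (2 * q)) *\<^sub>R G"
    by (simp add: vec_eq_iff signed_lag_def G_def q_def)
  have \<sigma>\<epsilon>: "\<sigma> * \<epsilon> = c j"
    using \<epsilon> by (simp add: \<sigma>_def power2_eq_square flip: \<epsilon>(1))
  have \<Sigma>G: "\<Sigma> = mat 1 + \<sigma> *\<^sub>R G"
  proof -
    have "c (lag k l) = (if k = l then 1 else 0) + \<sigma> * ?f (lag k l)" for k l :: 'p
      using c \<sigma>\<epsilon> j lag_less[of k l] by (cases "lag k l = 0") (auto simp: Suc_le_eq simp flip: neq0_conv)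
    then show ?thesis by (simp add: vec_eq_iff \<Sigma>(2) G_def mat_def)
  qed
  have "transpose G = G" by (simp add: G_def)
  then obtain U g where U: "orthogonal_matrix U" "transpose U ** G ** U = diag_mat g"
    using symmetric_matrix_diagonalization by blast
  have UU: "transpose U ** U = mat 1" "U ** transpose U = mat 1"
    using U(1) by (simp_all add: orthogonal_matrix_def)
  have \<Sigma>x: "x \<bullet> (\<Sigma> *v x) = x \<bullet> x + \<sigma> * (x \<bullet> (G *v x))" for x
    by (simp add: \<Sigma>G matrix_vector_mult_add_rdistrib inner_add_right scaleR_matrix_vector_assoc[symmetric])
  have pos: "x \<bullet> x + \<sigma> * (x \<bullet> (G *v x)) > 0" if "x \<noteq> 0" for x
    using \<Sigma>(1) that by (simp add: sym_pos_def_def flip: \<Sigma>x)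
  have \<sigma>g: "\<bar>\<sigma> * g i\<bar> \<le> 1" for i
  proof -
    define x where "x = U *v axis i 1"
    have "x \<bullet> (C *v x) = (transpose U ** C ** U) $ i $ i" for C
      unfolding x_def inner_matrix_congruence[symmetric]
      by (simp add: matrix_vector_mul_component inner_axis' row_def inner_axis)
    from this[of G] this[of "mat 1", unfolded matrix_mul_rid matrix_vector_mul_lid UU] have x: "x \<bullet> (G *v x) = g i" "x \<bullet> x = 1"
      by (simp_all add: U(2) UU mat_def)
    \<comment> \<open>The sign-flipped eigenvector has the opposite value of the form, so positive
      definiteness at \<open>x\<close> and \<open>x'\<close> bounds \<open>\<sigma> * g i\<close>
      from both sides.\<close>
    obtain x' where x': "x' \<bullet> x' = x \<bullet> x" "x' \<bullet> (G *v x') = - (x \<bullet> (G *v x))"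
      unfolding G_def using single_lag_negate[OF j(1), of ?f x] by auto
    have "x \<noteq> 0" "x' \<noteq> 0" using x x' by auto
    then show ?thesis using pos[of x] pos[of x'] by (simp add: x x')
  qed
  define D where "D = diag_mat (\<lambda>i. sqrt (1 + \<sigma> * g i))"
  have g_ge: "1 + \<sigma> * g i \<ge> 0" for i using \<sigma>g[of i] by linarith
  define M where "M = U ** D"
  have DT: "transpose D = D" by (simp add: D_def)
  have U\<Sigma>: "transpose U ** \<Sigma> ** U = D ** D"
  proof -
    have "transpose U ** \<Sigma> ** U = transpose U ** U + \<sigma> *\<^sub>R (transpose U ** G ** U)"
      by (simp add: \<Sigma>G matrix_add_ldistrib matrix_add_mult_distrib scalar_matrix_assoc matrix_scalar_ac)
    then show ?thesis by (simp add: UU U(2) D_def diag_mat_mult vec_eq_iff mat_def g_ge)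
  qed
  have MM: "M ** transpose M = \<Sigma>"
  proof -
    have "M ** transpose M = U ** (D ** D) ** transpose U"
      by (simp add: M_def matrix_transpose_mul DT matrix_mul_assoc)
    also have "\<dots> = (U ** transpose U) ** \<Sigma> ** (U ** transpose U)"
      by (simp flip: U\<Sigma> add: matrix_mul_assoc)
    finally show ?thesis by (simp add: UU)
  qed
  define \<mu> where "\<mu> i = g i * (1 + \<sigma> * g i) / (2 * q)" for i
  have M\<mu>: "transpose M ** ?B ** M = diag_mat \<mu>"
  proof -
    have "transpose M ** ?B ** M = (1 / (2 * q)) *\<^sub>R (D ** (transpose U ** G ** U) ** D)"
      by (simp add: M_def B matrix_transpose_mul DT matrix_mul_assoc scalar_matrix_assoc matrix_scalar_ac)
    also have "\<dots> = diag_mat \<mu>"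
      using g_ge by (simp add: U(2) D_def diag_mat_mult vec_eq_iff \<mu>_def mult_ac)
    finally show ?thesis .
  qed
  have sums: "sum g UNIV = 0" "(\<Sum>i\<in>UNIV. (g i)\<^sup>2) = 2 * q" "(\<Sum>i\<in>UNIV. (g i) ^ 3) = 0"
  proof -
    note sum_diag_mat_conjugate[OF U]
    moreover have "trace G = 0" using j by (simp add: trace_def G_def)
    moreover have "trace (G ** G) = 2 * q"
      unfolding G_def using j \<epsilon>(2)
      by (subst trace_lag_toeplitz_mult[of "{j}"]) (auto simp: q_def power2_eq_square)
    moreover have "trace (G ** (G ** G)) = 0"
      unfolding G_def by (rule trace_single_lag_cube[OF j(1)]) simp
    ultimately show "sum g UNIV = 0" "(\<Sum>i\<in>UNIV. (g i)\<^sup>2) = 2 * q" "(\<Sum>i\<in>UNIV. (g i) ^ 3) = 0"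
      by simp_all
  qed
  \<comment> \<open>Chernoff's bound is used at \<open>c = q * y\<close>; for
    \<open>h = \<sigma> * g i\<close> this makes \<open>2 * c * \<mu> i\<close> equal to
    \<open>k * h * (1 + h)\<close>, and \<open>4 * y \<le> \<bar>c j\<bar>\<close> becomes
    \<open>k \<le> 1 / 4\<close>.\<close>
  define k where "k = y / \<sigma>"
  have k: "0 \<le> k" "k \<le> 1 / 4"
    using y0 \<sigma> cj(2) by (simp_all add: k_def \<sigma>_def field_simps)
  have w: "2 * (q * y) * \<mu> i = k * (\<sigma> * g i) * (1 + \<sigma> * g i)" for i
    using q \<sigma> by (simp add: \<mu>_def k_def)
  have "(\<Sum>i\<in>UNIV. k * (\<sigma> * g i) * (1 + \<sigma> * g i) - k\<^sup>2 * (\<sigma> * g i)\<^sup>2 * (1 + \<sigma> * g i))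
      \<le> (\<Sum>i\<in>UNIV. ln (1 + 2 * (q * y) * \<mu> i))"
    unfolding w by (intro sum_mono ln_one_plus_lower_bound_cubic k \<sigma>g)
  moreover have "(\<Sum>i\<in>UNIV. k * (\<sigma> * g i) * (1 + \<sigma> * g i) - k\<^sup>2 * (\<sigma> * g i)\<^sup>2 * (1 + \<sigma> * g i)) =
      (\<Sum>i\<in>UNIV. y * g i + (y * \<sigma> - y\<^sup>2) * (g i)\<^sup>2 - y\<^sup>2 * \<sigma> * (g i) ^ 3)"
    using \<sigma> by (intro sum.cong) (simp_all add: k_def power2_eq_square power3_eq_cube field_simps)
  moreover have "\<dots> = 2 * q * (y * \<sigma> - y\<^sup>2)"
    by (simp add: sum.distrib sum_subtractf sum_distrib_left[symmetric] sums)
  ultimately have L: "2 * q * (y * \<sigma> - y\<^sup>2) \<le> (\<Sum>i\<in>UNIV. ln (1 + 2 * (q * y) * \<mu> i))"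
    by simp
  have qy: "q * y \<ge> 0" using q y0 by simp
  have pos': "1 + 2 * (q * y) * \<mu> i > 0" for i
    using ln_one_plus_lower_bound_cubic(2)[OF \<sigma>g[of i] k] unfolding w by linarith
  have "q * y * (n * (\<sigma> - \<delta>)) - n * (\<Sum>i\<in>UNIV. ln (1 + 2 * (q * y) * \<mu> i)) / 2
      \<le> q * y * (n * (\<sigma> - \<delta>)) - n * (2 * q * (y * \<sigma> - y\<^sup>2)) / 2"
    using mult_left_mono[OF L of_nat_0_le_iff[of n]] by linarith
  \<comment> \<open>The terms in \<sigma> cancel: the signal appears equally in the mean and in the
    logarithmic bound.\<close>
  also have "\<dots> = n * q * (y\<^sup>2 - y * \<delta>)" by (simp add: field_simps power2_eq_square)
  also have "\<dots> \<le> n * q * (- y\<^sup>2)"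
    using mult_left_mono[OF \<delta> y0] q by (intro mult_left_mono) (auto simp: power2_eq_square)
  also have "\<dots> = - z" using n q by (simp add: y2)
  finally have *: "exp (q * y * (n * (\<sigma> - \<delta>)) - n * (\<Sum>i\<in>UNIV. ln (1 + 2 * (q * y) * \<mu> i)) / 2) \<le> exp (- z)"
    by simp
  have "(\<epsilon> * phi (A_mat j) (sample_cov n X - mat 1) \<le> \<bar>c j\<bar> - \<delta>) \<longleftrightarrow>
      (\<Sum>k=1..n. X k \<bullet> (?B *v X k)) \<le> n * (\<sigma> - \<delta>)" for X :: "nat \<Rightarrow> real^'p::{finite,linorder}"
  proof -
    have "\<epsilon> * phi (A_mat j) (sample_cov n X - mat 1) = (\<Sum>k=1..n. X k \<bullet> (?B *v X k)) / n"
      using j sum_phi_A_mat_sample_cov[of "{j}" j "\<lambda>_. \<epsilon>" n X] by simp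
    then show ?thesis using n by (simp add: \<sigma>_def pos_divide_le_eq mult.commute)
  qed
  then have "\<P>(X in iid_gaussian n \<Sigma>. \<epsilon> * phi (A_mat j) (sample_cov n X - mat 1) \<le> \<bar>c j\<bar> - \<delta>)
      = \<P>(X in iid_gaussian n \<Sigma>. (\<Sum>k=1..n. X k \<bullet> (?B *v X k)) \<le> n * (\<sigma> - \<delta>))"
    by simp
  also have "\<dots> \<le> exp (q * y * (n * (\<sigma> - \<delta>)) - n * (\<Sum>i\<in>UNIV. ln (1 + 2 * (q * y) * \<mu> i)) / 2)"
    by (rule gaussian_form_chernoff[OF \<Sigma>(1) transpose_signed_lag MM M\<mu> qy pos'])
  also note *
  finally show ?thesis .
qed


section \<open>Norm and margin estimates for at least two lags\<close>

lemma int_lag: "int (lag k l) = \<bar>int (pos k) - int (pos l)\<bar>"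
  by (simp add: lag_def)

text \<open>Three coordinates at spacing \<open>b\<close> carry a 3 by 3 principal block with zero
  corner entries, and positivity is tested on the vector \<open>(1, - 2 * c b, 1)\<close>.\<close>

lemma lag_correlation_half:
  fixes c :: "nat \<Rightarrow> real"
  assumes pd: "(lag_toeplitz c :: real^'p::{finite,linorder}^'p::{finite,linorder}) \<in> sym_pos_def"
    and c: "c 0 = 1" "c (2 * b) = 0" and b: "b \<ge> 1" "2 * b < CARD('p)"
  shows "(c b)\<^sup>2 \<le> 1 / 2"
proof -
  have "0 < CARD('p)" "b < CARD('p)" using b by auto
  then obtain k0 k1 k2 :: 'p where k: "pos k0 = 0" "pos k1 = b" "pos k2 = 2 * b"
    using b(2) by (metis obtain_pos)
  have lags: "lag k0 k1 = b" "lag k1 k0 = b" "lag k1 k2 = b" "lag k2 k1 = b" "lag k0 k2 = 2 * b" "lag k2 k0 = 2 * b"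
    by (simp_all add: lag_def k)
  have ne: "k0 \<noteq> k1" "k0 \<noteq> k2" "k1 \<noteq> k2" using k b by auto
  define x :: "real^'p::{finite,linorder}" where "x = axis k0 1 + (- 2 * c b) *\<^sub>R axis k1 1 + axis k2 1"
  have ax: "axis k 1 \<bullet> ((lag_toeplitz c :: real^'p::{finite,linorder}^'p::{finite,linorder}) *v axis l 1) = c (lag k l)" for k l :: 'p
    by (simp add: inner_axis' matrix_vector_mult_basis column_def)
  have "x $ k0 = 1" using ne by (simp add: x_def axis_def)
  then have "x \<noteq> 0" by auto
  then have "0 < x \<bullet> (lag_toeplitz c *v x)" using pd by (simp add: sym_pos_def_def)
  also have "x \<bullet> (lag_toeplitz c *v x) = 2 - 4 * (c b)\<^sup>2"
    unfolding x_def
    by (simp add: matrix_vector_right_distrib matrix_vector_mult_scaleR inner_add_left inner_add_right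
        ax lags c c(2)[unfolded mult.commute[of 2]] power2_eq_square algebra_simps)
  finally show ?thesis by simp
qed

text \<open>Two different solutions would be \<open>P + J\<close> and \<open>P - J\<close> with
  \<open>J \<noteq> 0\<close>. If \<open>\<bar>P\<bar> = J\<close>, one of them is 0, contrary to
  \<open>A \<ge> 1\<close>; otherwise one of them has absolute value \<open>A + B\<close>, which
  exceeds \<open>B\<close>.\<close>

lemma lag_triangle_unique:
  fixes A B P P1 P2 J :: int
  assumes "1 \<le> A" "A < B" "\<bar>P\<bar> = A \<or> \<bar>P\<bar> = B" "\<bar>P1\<bar> = A \<or> \<bar>P1\<bar> = B" "\<bar>P2\<bar> = A \<or> \<bar>P2\<bar> = B"
    "\<bar>P - P1\<bar> = J" "\<bar>P - P2\<bar> = J" "J = 0 \<or> J = A \<or> J = B"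
  shows "P1 = P2"
  using assms by (smt (verit))

text \<open>
  The factor \<open>1 + \<Sum>\<^sub>j \<bar>c\<^sub>j\<bar>\<close>, instead of \<open>1 + 2 \<Sum>\<^sub>j \<bar>c\<^sub>j\<bar>\<close>, is needed for \<open>s = 2\<close>: among the coordinates
  \<open>k \<plusminus> a\<close>, \<open>k \<plusminus> b\<close> that support the column, each has at most one neighbour at any given lag in \<open>T\<close>.
\<close>

lemma column_signed_lag_form_le:
  fixes c \<epsilon> :: "nat \<Rightarrow> real"
  assumes T: "T = {a, b}" "1 \<le> a" "a < b"
    and c: "c 0 = 1" "\<And>i. 1 \<le> i \<Longrightarrow> i < CARD('p) \<Longrightarrow> i \<notin> T \<Longrightarrow> c i = 0"
  defines "y k \<equiv> column k (signed_lag T \<epsilon> :: real^'p::{finite,linorder}^'p::{finite,linorder})"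
  shows "y k \<bullet> (lag_toeplitz c *v y k) \<le> (1 + (\<Sum>j\<in>T. \<bar>c j\<bar>)) * (y k \<bullet> y k)"
proof -
  define N where "N = {l :: 'p. lag l k \<in> T}"
  have "\<bar>y k \<bullet> (lag_toeplitz c *v y k)\<bar> \<le> (1 + (\<Sum>j\<in>T. \<bar>c j\<bar>)) * (y k \<bullet> y k)"
  proof (rule abs_inner_matrix_le_row_sum[where N = N])
    fix l assume l: "l \<in> N"
    have "(\<Sum>l'\<in>N. \<bar>c (lag l l')\<bar>) \<le> real 1 * (\<Sum>j\<in>insert 0 T. \<bar>c j\<bar>)"
    proof (rule sum_lag_row_le)
      fix j assume j: "j \<in> insert 0 T"
      have "l1 = l2" if "l1 \<in> N" "lag l l1 = j" "l2 \<in> N" "lag l l2 = j" for l1 l2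
      proof -
        define P P1 P2 where "P = int (pos l) - int (pos k)" and "P1 = int (pos l1) - int (pos k)"
          and "P2 = int (pos l2) - int (pos k)"
        have in_T: "\<bar>P\<bar> = int a \<or> \<bar>P\<bar> = int b" "\<bar>P1\<bar> = int a \<or> \<bar>P1\<bar> = int b" "\<bar>P2\<bar> = int a \<or> \<bar>P2\<bar> = int b"
          using l that(1,3) by (auto simp: N_def T(1) P_def P1_def P2_def int_lag[symmetric])
        have "\<bar>P - P1\<bar> = int j" "\<bar>P - P2\<bar> = int j"
          using that(2,4) by (auto simp: P_def P1_def P2_def lag_def)
        moreover have "j = 0 \<or> j = a \<or> j = b" using j T by auto
        ultimately show "l1 = l2"
          using in_T lag_triangle_unique[of "int a" "int b" P P1 P2 "int j"] T(2,3)
          by (auto simp: P1_def P2_def)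
      qed
      then show "card {l' \<in> N. lag l l' = j} \<le> 1"
        by (auto simp: card_le_Suc0_iff_eq)
    next
      fix i assume "i < CARD('p)" "i \<notin> insert 0 T"
      then show "\<bar>c i\<bar> = 0" using c(2)[of i] by simp
    qed (auto simp: T(1))
    then show "(\<Sum>l'\<in>N. \<bar>(lag_toeplitz c :: real^'p::{finite,linorder}^'p::{finite,linorder}) $ l $ l'\<bar>) \<le> 1 + (\<Sum>j\<in>T. \<bar>c j\<bar>)"
      using T c by simp
  qed (auto simp: N_def y_def column_def signed_lag_def)
  then show ?thesis by simp
qed

lemma lag_toeplitz_form_le:
  fixes x :: "real^'p::{finite,linorder}"
  assumes T: "finite T" "0 \<notin> T" and c: "c 0 = 1" "\<And>i. 1 \<le> i \<Longrightarrow> i < CARD('p) \<Longrightarrow> i \<notin> T \<Longrightarrow> c i = 0"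
  shows "x \<bullet> (lag_toeplitz c *v x) \<le> (1 + 2 * (\<Sum>j\<in>T. \<bar>c j\<bar>)) * (x \<bullet> x)"
proof -
  let ?f = "\<lambda>i. if i \<in> T then c i else 0"
  have "c (lag k l) = (if k = l then 1 else 0) + ?f (lag k l)" for k l :: 'p
    using c T lag_less[of k l] by (cases "lag k l = 0") (auto simp: Suc_le_eq simp flip: neq0_conv)
  then have "(lag_toeplitz c :: real^'p::{finite,linorder}^'p::{finite,linorder}) = mat 1 + lag_toeplitz ?f"
    by (simp add: vec_eq_iff mat_def)
  then have "x \<bullet> (lag_toeplitz c *v x) = x \<bullet> x + x \<bullet> (lag_toeplitz ?f *v x)"
    by (simp add: matrix_vector_mult_add_rdistrib inner_add_right)
  moreover have "\<bar>x \<bullet> (lag_toeplitz ?f *v x)\<bar> \<le> 2 * (\<Sum>j\<in>T. \<bar>?f j\<bar>) * (x \<bullet> x)"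
    using T by (intro abs_inner_lag_toeplitz_le) auto
  ultimately show ?thesis by (simp add: algebra_simps)
qed

text \<open>The decimals are roundings of \<open>1 / (2 sqrt 2)\<close> and \<open>sqrt 6 / 4\<close> here, of \<open>1 / (6 sqrt 2)\<close> in the
  next lemma.\<close>

lemma deviation_le_margin_3:
  fixes s M x \<sigma> t :: real
  assumes s: "s \<ge> 3" and x: "x \<ge> 0" and M: "M \<ge> s * \<sigma>" and \<sigma>: "\<sigma> \<ge> 2 * (s + 1) * x" "\<sigma>\<^sup>2 \<le> 1 / 2"
    and t: "t \<le> \<sigma> - 2 * x"
  shows "sqrt (2 * s * (1 + 2 * M) * (1 + 2 * M)) * x + 2 * s * (1 + 2 * M) * x\<^sup>2 \<le> M - t"
proof -
  \<comment> \<open>In this scale the lower bound on \<sigma> reads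
    \<open>2 * X \<le> \<sigma>\<close>, so that \<open>\<sigma>\<^sup>2 \<le> 1 / 2\<close> bounds
    \<open>X\<close>.\<close>
  define X where "X = (s + 1) * x"
  have X: "X \<ge> 0" "2 * X \<le> \<sigma>" using s x \<sigma>(1) by (simp_all add: X_def algebra_simps)
  have "(2 * X)\<^sup>2 \<le> 1 / 2" using power_mono[OF X(2), of 2] X(1) \<sigma>(2) by simp
  then have X_le: "X \<le> 0.3536"
    using power2_le_imp_le[of X "0.3536"] by (simp add: power2_eq_square)
  have "s * (2 * X) \<le> s * \<sigma>" using X(2) s by (intro mult_left_mono) auto
  then have M6: "M \<ge> 2 * s * X" using M by linarith
  then have M0: "M \<ge> 0" using X(1) s by (meson mult_nonneg_nonneg order_trans zero_le_numeral)
  define r where "r = sqrt (2 * s)"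
  have "r \<le> 0.6125 * (s + 1)"
    unfolding r_def
  proof (rule real_le_lsqrt)
    \<comment> \<open>As \<open>0.6125 = 49 / 80\<close>, clearing denominators gives
      \<open>2401 * s\<^sup>2 - 7998 * s + 2401 \<ge> 0\<close>; lowering the constant to 2385
      yields this factorization.\<close>
    have "0 \<le> (s - 3) * (2401 * s - 795) " using s by (intro mult_nonneg_nonneg) auto
    then show "2 * s \<le> (0.6125 * (s + 1))\<^sup>2"
      using s by (simp add: power2_eq_square algebra_simps)
  qed (use s in auto)
  from mult_right_mono[OF this x] have rx: "r * x \<le> 0.6125 * X" by (simp add: X_def algebra_simps)
  have "16 * s \<le> 3 * (s + 1)\<^sup>2"
    using mult_nonneg_nonneg[of "s - 3" "3 * s - 1"] s by (simp add: power2_eq_square algebra_simps)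
  from mult_right_mono[OF this, of "x\<^sup>2"] have "16 * (s * x\<^sup>2) \<le> 3 * X\<^sup>2"
    by (simp add: X_def power_mult_distrib mult_ac)
  moreover have "X\<^sup>2 \<le> 0.3536 * X" using mult_right_mono[OF X_le X(1)] by (simp add: power2_eq_square)
  ultimately have sx: "2 * s * x\<^sup>2 \<le> 0.1326 * X" by simp
  define A where "A = r * x + 2 * s * x\<^sup>2"
  have A: "A \<le> 0.7451 * X" using rx sx by (simp add: A_def)
  have sqrt_eq: "sqrt (2 * s * (1 + 2 * M) * (1 + 2 * M)) = r * (1 + 2 * M)"
    using M0 by (simp add: r_def real_sqrt_mult)
  have "3 * \<sigma> \<le> s * \<sigma>" using s X by (intro mult_right_mono) auto
  then have \<sigma>M: "3 * \<sigma> \<le> M" using M by simp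
  have "M * A \<le> M * 0.26347" using A X_le M0 by (intro mult_left_mono) auto
  moreover have "2 * s * X \<ge> 6 * X" using s X(1) by (intro mult_right_mono) auto
  \<comment> \<open>The term \<open>2 * M * A\<close> costs less than \<open>0.527 * M\<close> and
    \<sigma> at most \<open>M / 3\<close>; the remaining part of \<open>M\<close>, at least
    \<open>0.139 * M\<close>, covers \<open>A\<close> because \<open>M \<ge> 6 * X\<close>.\<close>
  ultimately have "(1 + 2 * M) * A \<le> M - \<sigma>"
    using A \<sigma>M M6 X(1) by (simp add: algebra_simps)
  then show ?thesis
    unfolding sqrt_eq using t x by (simp add: A_def algebra_simps)
qed

lemma deviation_le_margin_2:
  fixes M x \<sigma> t :: real
  assumes x: "x \<ge> 0" and M: "M \<ge> 2 * \<sigma>" and \<sigma>: "\<sigma> \<ge> 6 * x" "\<sigma>\<^sup>2 \<le> 1 / 2" and t: "t \<le> \<sigma> - 2 * x"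
  shows "sqrt (4 * (1 + 2 * M) * (1 + M)) * x + 4 * (1 + 2 * M) * x\<^sup>2 \<le> M - t"
proof -
  have "(6 * x)\<^sup>2 \<le> 1 / 2" using power_mono[OF \<sigma>(1), of 2] x \<sigma>(2) by simp
  then have x_le: "x \<le> 0.11786"
    using power2_le_imp_le[of x "0.11786"] by (simp add: power2_eq_square)
  have M12: "M \<ge> 12 * x" using M \<sigma>(1) by simp
  then have M0: "M \<ge> 0" using x by simp
  have "sqrt (4 * (1 + 2 * M) * (1 + M)) \<le> 2.05 + 2.85 * M"
  proof (rule real_le_lsqrt)
    \<comment> \<open>This square is exactly the difference of the two sides of the next inequality;
      the linear bound touches the root at \<open>M = 9 / 7\<close>.\<close>
    have "0 \<le> (0.45 - 0.35 * M)\<^sup>2" by simp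
    then show "4 * (1 + 2 * M) * (1 + M) \<le> (2.05 + 2.85 * M)\<^sup>2"
      by (simp add: power2_eq_square algebra_simps)
  qed (use M0 in auto)
  from mult_right_mono[OF this x]
  have "sqrt (4 * (1 + 2 * M) * (1 + M)) * x \<le> 2.05 * x + 2.85 * (M * x)" by (simp add: algebra_simps)
  moreover have x2: "x\<^sup>2 \<le> 0.11786 * x"
    using mult_right_mono[OF x_le x] by (simp add: power2_eq_square)
  moreover have "M * x\<^sup>2 \<le> M * (0.11786 * x)" using x2 M0 by (rule mult_left_mono)
  moreover have "M * x \<le> M * 0.11786" using x_le M0 by (rule mult_left_mono)
  \<comment> \<open>The target is \<open>M / 2 + 2 * x\<close>, since
    \<open>t \<le> \<sigma> - 2 * x\<close> and \<open>2 * \<sigma> \<le> M\<close>.\<close>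
  ultimately have "sqrt (4 * (1 + 2 * M) * (1 + M)) * x + 4 * (1 + 2 * M) * x\<^sup>2 \<le> M / 2 + 2 * x"
    using M12 x by (simp add: algebra_simps)
  then show ?thesis using M t by simp
qed

section \<open>The two error probabilities\<close>


lemma borel_measurable_phi_sample_cov [measurable]:
  "(\<lambda>X. phi B (sample_cov n X - Z)) \<in> borel_measurable (iid_gaussian n \<Sigma>)"
proof -
  have "phi B (sample_cov n X - Z) = (\<Sum>k=1..n. X k \<bullet> (B *v X k)) / real n - phi B Z" for X
  proof -
    have "phi B (Y - Z) = phi B Y - phi B Z" for Y
      by (simp add: phi_def trace_def matrix_matrix_mult_def right_diff_distrib sum_subtractf)
    then show ?thesis by (simp add: phi_sample_cov)
  qed
  then show ?thesis by simp
qed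

lemma finite_index_sets: "finite {T. T \<subseteq> {1..S :: nat} \<and> card T = s}"
  by (rule finite_subset[of _ "Pow {1..S}"]) auto

lemma test_HS_eq_1D:
  fixes X :: "nat \<Rightarrow> real^'p::{finite,linorder}"
  assumes "test_HS n s S u X = 1" "s \<le> S"
  obtains T where "T \<subseteq> {1..S}" "card T = s"
    "threshold_HS n CARD('p) s S u \<le> (\<Sum>j\<in>T. \<bar>phi (A_mat j) (sample_cov n X - mat 1)\<bar>)"
proof -
  let ?I = "{T. T \<subseteq> {1..S} \<and> card T = s}"
  let ?P = "\<lambda>T. (\<Sum>j\<in>T. \<bar>phi (A_mat j) (sample_cov n X - mat 1)\<bar>) \<ge> threshold_HS n CARD('p) s S u"
  have "{1..s} \<in> ?I" using assms(2) by auto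
  then have "?I \<noteq> {}" by blast
  then have "(MAX T\<in>?I. of_bool (?P T) :: nat) \<in> (\<lambda>T. of_bool (?P T)) ` ?I"
    using finite_index_sets by (intro Max_in finite_imageI) (simp_all only: image_is_empty not_False_eq_True)
  then obtain T where T: "(MAX T\<in>?I. of_bool (?P T) :: nat) = of_bool (?P T)" "T \<in> ?I"
    by (rule imageE)
  have "of_bool (?P T) = (1 :: nat)" using T(1)[symmetric] assms(1) unfolding test_HS_def by (rule trans)
  then have "?P T" by (simp only: of_bool_eq_1_iff)
  then show ?thesis using T(2) that by blast
qed

lemma test_HS_eq_0D:
  fixes X :: "nat \<Rightarrow> real^'p::{finite,linorder}"
  assumes "test_HS n s S u X = 0" "T \<subseteq> {1..S}" "card T = s"
  shows "(\<Sum>j\<in>T. \<bar>phi (A_mat j) (sample_cov n X - mat 1)\<bar>) < threshold_HS n CARD('p) s S u"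
proof -
  let ?I = "{T. T \<subseteq> {1..S} \<and> card T = s}"
  let ?P = "\<lambda>T. (\<Sum>j\<in>T. \<bar>phi (A_mat j) (sample_cov n X - mat 1)\<bar>) \<ge> threshold_HS n CARD('p) s S u"
  have "(of_bool (?P T) :: nat) \<le> (MAX T\<in>?I. of_bool (?P T))"
    using finite_index_sets assms by (intro Max_ge) auto
  then have "\<not> ?P T" using assms(1) unfolding test_HS_def by (simp only: le_zero_eq of_bool_eq_0_iff not_False_eq_True)
  then show ?thesis by simp
qed

text \<open>Absorption identity for binomial coefficients. It lets one factor \<open>exp L\<close>,
  \<open>L\<close> being the logarithm in the threshold, pay for a union over \<open>S\<close>
  lags.\<close>

lemma le_mult_binomial:
  assumes "1 \<le> s" "s \<le> S"
  shows "S \<le> s * (S choose s)"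
proof -
  have "s * (S choose s) = S * ((S - 1) choose (s - 1))"
    using times_binomial_minus1_eq[of s S] assms by simp
  moreover have "(S - 1) choose (s - 1) \<ge> 1"
    using assms by (simp add: Suc_leI zero_less_binomial)
  ultimately show ?thesis by simp
qed

text \<open>The threshold is \<open>s * \<tau>\<close>, so if the sum over some \<open>T\<close>
  reaches it, a single lag statistic reaches \<tau>. The union therefore runs over
  \<open>2 * S\<close> pairs of a lag and a sign, not over the index sets.\<close>

lemma test_HS_type_I:
  fixes n s S :: nat and u :: real
  assumes n: "n \<ge> 1" and s: "1 \<le> s" "s \<le> S" and S: "S < CARD('p::{finite,linorder})" and u: "u > 1"
  shows "\<P>(X in iid_gaussian n (mat 1 :: real^'p::{finite,linorder}^'p::{finite,linorder}). test_HS n s S u X = 1)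
    \<le> 2 * exp (- ((u - 1) * ln (real (s * (S choose s)))))"
proof -
  let ?M = "iid_gaussian n (mat 1 :: real^'p::{finite,linorder}^'p::{finite,linorder})"
  define L where "L = ln (real (s * (S choose s)))"
  define R where "R = real (s * (S choose s))"
  have "real S \<le> R" unfolding R_def using le_mult_binomial[OF s] by (simp only: of_nat_le_iff)
  moreover have "real S \<ge> 1" using s by simp
  ultimately have L: "L \<ge> 0" "real S \<le> exp L"
    by (auto simp: L_def R_def[symmetric] simp del: of_nat_mult)
  define x where "x = sqrt (u * L / (n * (real CARD('p) - real S)))"
  define \<tau> where "\<tau> = max (2 * x) (8 * x\<^sup>2)"
  have z: "u * L \<ge> 0" using L u by simp
  have x2: "x\<^sup>2 = u * L / (n * (real CARD('p) - real S))" using z S by (simp add: x_def)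
  have "2 * x = sqrt (4 * (u * L / (n * (real CARD('p) - real S))))"
    unfolding x_def real_sqrt_mult[of 4] by simp
  then have thr: "threshold_HS n CARD('p) s S u = s * \<tau>"
    unfolding threshold_HS_def \<tau>_def x2 L_def[symmetric] by (simp add: mult.assoc)
  interpret prob_space ?M
    by (rule prob_space_iid_gaussian) (auto simp: sym_pos_def_def)
  define E where "E i = {X \<in> space ?M. snd i * phi (A_mat (fst i)) (sample_cov n X - mat 1) \<le> - \<tau>}" for i :: "nat \<times> real"
  have E: "E i \<in> sets ?M" for i unfolding E_def by measurable
  let ?I = "{1..S} \<times> {1, - 1 :: real}"
  have "{X \<in> space ?M. test_HS n s S u X = 1} \<subseteq> (\<Union>i\<in>?I. E i)"
  proof safe
    fix X assume X: "X \<in> space ?M" and test: "test_HS n s S u X = 1"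
    obtain T where T: "T \<subseteq> {1..S}" "card T = s"
      "s * \<tau> \<le> (\<Sum>j\<in>T. \<bar>phi (A_mat j) (sample_cov n X - mat 1)\<bar>)"
      using test_HS_eq_1D[OF test s(2)] unfolding thr by blast
    have "finite T" "T \<noteq> {}" using T s by (auto intro: finite_subset)
    have "\<exists>j\<in>T. \<tau> \<le> \<bar>phi (A_mat j) (sample_cov n X - mat 1)\<bar>"
    proof (rule ccontr)
      assume "\<not> ?thesis"
      then have "(\<Sum>j\<in>T. \<bar>phi (A_mat j) (sample_cov n X - mat 1)\<bar>) < (\<Sum>j\<in>T. \<tau>)"
        using \<open>finite T\<close> \<open>T \<noteq> {}\<close> by (intro sum_strict_mono) auto
      then show False using T by simp
    qed
    then obtain j where j: "j \<in> T" "\<tau> \<le> \<bar>phi (A_mat j) (sample_cov n X - mat 1)\<bar>" by blast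
    then have "X \<in> E (j, 1) \<or> X \<in> E (j, - 1)"
      using X by (auto simp: E_def abs_if split: if_splits)
    then show "X \<in> (\<Union>i\<in>?I. E i)" using j T by blast
  qed
  then have "prob {X \<in> space ?M. test_HS n s S u X = 1} \<le> prob (\<Union>i\<in>?I. E i)"
    using E by (intro finite_measure_mono) auto
  also have "\<dots> \<le> (\<Sum>i\<in>?I. prob (E i))"
    using E by (intro finite_measure_subadditive_finite) auto
  also have "\<dots> \<le> (\<Sum>i\<in>?I. exp (- (u * L)))"
  proof (rule sum_mono)
    fix i assume "i \<in> ?I"
    then show "prob (E i) \<le> exp (- (u * L))"
      unfolding E_def
      by (intro phi_A_mat_null_tail[where S=S and x=x]) (use n in \<open>auto simp: z S x_def[symmetric] \<tau>_def[symmetric]\<close>)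
  qed
  also have "\<dots> = 2 * (real S * exp (- (u * L)))" by (simp add: card_cartesian_product)
  also have "\<dots> \<le> 2 * (exp L * exp (- (u * L)))" using L by (simp add: mult_right_mono)
  also have "\<dots> = 2 * exp (- ((u - 1) * L))" by (simp add: exp_add[symmetric] algebra_simps)
  finally show ?thesis by (simp add: L_def)
qed

text \<open>Acceptance keeps the statistic of the true support below the threshold \<open>t\<close>,
  and with it the sum signed by the correlations. As the latter has mean \<open>M\<close>, it must
  fall short of its mean by \<open>M - t\<close>.\<close>

lemma test_HS_type_II:
  fixes n s S :: nat and u \<sigma> x :: real and \<Sigma> :: "real^'p::{finite,linorder}^'p::{finite,linorder}"
  assumes n: "n \<ge> 1" and s: "1 \<le> s" and S: "2 * S < CARD('p)" and \<sigma>: "\<sigma> > 0"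
    and z: "z \<ge> 0" and x: "x = sqrt (z / (n * (real CARD('p) - real S)))"
    and thr: "2 * real s * x \<le> threshold_HS n CARD('p) s S u" "threshold_HS n CARD('p) s S u + 2 * x \<le> \<sigma>"
    and \<Sigma>: "\<Sigma> \<in> sparse_class s S \<sigma>"
  shows "\<P>(X in iid_gaussian n \<Sigma>. test_HS n s S u X = 0) \<le> exp (- z)"
proof -
  define t where "t = threshold_HS n CARD('p) s S u"
  obtain c T where pd: "\<Sigma> \<in> sym_pos_def" and c: "\<forall>k l. \<Sigma> $ k $ l = c (lag k l)" "c 0 = 1"
    and T: "T \<subseteq> {1..S}" "card T = s" and cT: "\<forall>j\<in>T. \<bar>c j\<bar> \<ge> \<sigma>" "\<forall>j\<in>{1..CARD('p) - 1} - T. c j = 0"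
    using \<Sigma> unfolding sparse_class_def by blast
  have \<Sigma>c: "\<Sigma> = lag_toeplitz c" using c by (simp add: vec_eq_iff)
  have c0: "c i = 0" if "1 \<le> i" "i < CARD('p)" "i \<notin> T" for i using that cT(2) by auto
  have finT: "finite T" and neT: "T \<noteq> {}" using T s by (auto intro: finite_subset)
  have x0: "x \<ge> 0" using z S by (simp add: x)
  interpret prob_space "iid_gaussian n \<Sigma>" by (rule prob_space_iid_gaussian[OF pd])
  define M where "M = (\<Sum>j\<in>T. \<bar>c j\<bar>)"
  have M\<sigma>: "s * \<sigma> \<le> M"
    using sum_mono[of T "\<lambda>_. \<sigma>" "\<lambda>j. \<bar>c j\<bar>"] cT(1) T(2) by (simp add: M_def)
  define \<epsilon> where "\<epsilon> j = (if c j \<ge> 0 then 1 else - 1 :: real)" for j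
  have \<epsilon>: "\<epsilon> j * c j = \<bar>c j\<bar>" "(\<epsilon> j)\<^sup>2 = 1" "\<bar>\<epsilon> j\<bar> \<le> 1" "\<epsilon> j * r \<le> \<bar>r\<bar>" for j r
    by (auto simp: \<epsilon>_def)
  have "\<P>(X in iid_gaussian n \<Sigma>. test_HS n s S u X = 0)
      \<le> \<P>(X in iid_gaussian n \<Sigma>. (\<Sum>j\<in>T. \<epsilon> j * phi (A_mat j) (sample_cov n X - mat 1)) \<le> M - (M - t))"
  proof (rule finite_measure_mono)
    show "{X \<in> space (iid_gaussian n \<Sigma>). test_HS n s S u X = 0} \<subseteq>
        {X \<in> space (iid_gaussian n \<Sigma>). (\<Sum>j\<in>T. \<epsilon> j * phi (A_mat j) (sample_cov n X - mat 1)) \<le> M - (M - t)}"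
    proof safe
      fix X :: "nat \<Rightarrow> real^'p::{finite,linorder}" assume "test_HS n s S u X = 0"
      from test_HS_eq_0D[OF this T]
      have "(\<Sum>j\<in>T. \<bar>phi (A_mat j) (sample_cov n X - mat 1)\<bar>) < t" by (simp add: t_def)
      moreover have "(\<Sum>j\<in>T. \<epsilon> j * phi (A_mat j) (sample_cov n X - mat 1)) \<le> (\<Sum>j\<in>T. \<bar>phi (A_mat j) (sample_cov n X - mat 1)\<bar>)"
        by (intro sum_mono \<epsilon>)
      ultimately show "(\<Sum>j\<in>T. \<epsilon> j * phi (A_mat j) (sample_cov n X - mat 1)) \<le> M - (M - t)" by simp
    qed
  qed measurable
  also have "\<dots> \<le> exp (- z)"
  proof (cases "s = 1")
    case True
    then obtain j where Tj: "T = {j}" using T(2) by (auto simp: card_1_singleton_iff)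
    have j: "1 \<le> j" "j \<le> S" "j < CARD('p)" using T(1) S Tj by auto
    define y where "y = sqrt (z / (n * (real CARD('p) - real j)))"
    have "z / (n * (real CARD('p) - real j)) \<le> z / (n * (real CARD('p) - real S))"
      using j S z n by (intro divide_left_mono mult_left_mono mult_pos_pos) auto
    then have yx: "y \<le> x" by (simp add: y_def x)
    have "\<P>(X in iid_gaussian n \<Sigma>. \<epsilon> j * phi (A_mat j) (sample_cov n X - mat 1) \<le> \<bar>c j\<bar> - (M - t)) \<le> exp (- z)"
    proof (rule single_lag_lower_tail[OF pd \<Sigma>c c(2) _ j(1,3) \<epsilon>(1,2) n z y_def])
      have \<sigma>j: "\<sigma> \<le> \<bar>c j\<bar>" using cT(1) Tj by simp
      then show "c j \<noteq> 0" using \<sigma> by auto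
      \<comment> \<open>For \<open>s = 1\<close> the hypotheses on the threshold give
        \<open>t \<ge> 2 * x\<close> and \<open>\<sigma> \<ge> t + 2 * x\<close>, hence
        \<open>\<sigma> \<ge> 4 * x\<close>; and \<open>y \<le> x\<close> because
        \<open>j \<le> S\<close>.\<close>
      show "4 * y \<le> \<bar>c j\<bar>" "2 * y \<le> M - t"
        using yx thr \<sigma>j True by (auto simp: M_def Tj t_def)
    qed (use c0 Tj in auto)
    then show ?thesis by (simp add: M_def Tj)
  next
    case False
    then have s2: "s \<ge> 2" using s by simp
    \<comment> \<open>Twice the largest lag lies outside the support but still below the dimension,
      as \<open>2 * S < CARD('p)\<close>; so the correlation at \<open>2 * b\<close>
      vanishes.\<close>
    define b where "b = Max T"
    have b: "b \<in> T" "\<And>j. j \<in> T \<Longrightarrow> j \<le> b" using finT neT by (auto simp: b_def)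
    have b1: "1 \<le> b" "2 * b < CARD('p)" using b(1) T(1) S by auto
    have "2 * b \<notin> T" using b(2)[of "2 * b"] b1 by auto
    then have "c (2 * b) = 0" using b1 by (intro c0) auto
    from lag_correlation_half[OF pd[unfolded \<Sigma>c] c(2) this b1] have "(c b)\<^sup>2 \<le> 1 / 2" .
    moreover have "\<sigma>\<^sup>2 \<le> (c b)\<^sup>2" using cT(1) b(1) \<sigma> by (intro abs_le_square_iff[THEN iffD1]) auto
    ultimately have \<sigma>2: "\<sigma>\<^sup>2 \<le> 1 / 2" by linarith
    have M0: "M \<ge> 0" by (simp add: M_def sum_nonneg)
    have K: "v \<bullet> (\<Sigma> *v v) \<le> (1 + 2 * M) * (v \<bullet> v)" for v
      unfolding \<Sigma>c M_def using finT T(1) c(2) c0 by (intro lag_toeplitz_form_le) auto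
    have S': "S < CARD('p)" using S by simp
    have \<sigma>x: "2 * (real s + 1) * x \<le> \<sigma>" using thr by (simp add: algebra_simps)
    note tail = signed_lag_lower_tail[where \<epsilon> = \<epsilon> and \<delta> = "M - t",
        OF pd \<Sigma>c T(1) S' neT \<epsilon>(3) K _ _ _ n z x, unfolded \<epsilon>(1) M_def[symmetric] T(2)]
    show ?thesis
    proof (cases "s = 2")
      case True
      obtain a0 b0 where "T = {a0, b0}" "a0 \<noteq> b0" using T(2) True by (auto simp: card_2_iff)
      then have "T = {min a0 b0, max a0 b0}" "min a0 b0 < max a0 b0" by (auto simp: min_def max_def)
      then obtain a b' where ab': "T = {a, b'}" "a < b'" by blast
      then have ab: "T = {a, b'}" "1 \<le> a" "a < b'" using T(1) by auto
      have K': "column i (signed_lag T \<epsilon>) \<bullet> (\<Sigma> *v column i (signed_lag T \<epsilon>)) \<le>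
          (1 + M) * (column i (signed_lag T \<epsilon>) \<bullet> column i (signed_lag T \<epsilon>))" for i
        unfolding \<Sigma>c M_def
        by (rule column_signed_lag_form_le[where c = c and a = a and b = b', OF ab c(2)]) (rule c0)
      show ?thesis
      proof (rule tail[OF _ K'])
        show "0 < 1 + 2 * M" "0 < 1 + M" using M0 by auto
        have "sqrt (4 * (1 + 2 * M) * (1 + M)) * x + 4 * (1 + 2 * M) * x\<^sup>2 \<le> M - t"
          using M\<sigma> \<sigma>x thr True by (intro deviation_le_margin_2[OF x0 _ _ \<sigma>2]) (auto simp: t_def)
        then show "sqrt (2 * real s * (1 + 2 * M) * (1 + M)) * x + 2 * real s * (1 + 2 * M) * x\<^sup>2 \<le> M - t"
          using True by simp
      qed
    next
      case False
      show ?thesis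
      proof (rule tail[OF _ K])
        show "0 < 1 + 2 * M" "0 < 1 + 2 * M" using M0 by auto
        show "sqrt (2 * real s * (1 + 2 * M) * (1 + 2 * M)) * x + 2 * real s * (1 + 2 * M) * x\<^sup>2 \<le> M - t"
          using s2 False thr by (intro deviation_le_margin_3[OF _ x0 M\<sigma> \<sigma>x \<sigma>2]) (auto simp: t_def)
      qed
    qed
  qed
  finally show ?thesis .
qed

theorem theorem3p4:
  fixes n s S :: nat and u \<sigma> :: real
  assumes "n \<ge> 1" and "1 \<le> s" and "s \<le> S" and "real S < real CARD('p) / 2"
    and "u > 1" and "\<sigma> > 0"
    and "\<sigma> \<ge> threshold_HS n CARD('p) s S u +
      max (sqrt (4 * (u - 1) * ln (real (s * (2 * s + 1) * (S choose s))) /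
                 (real n * (real CARD('p) - real S))))
          (8 * (u - 1) * ln (real (s * (2 * s + 1) * (S choose s))) /
                 (real n * (real CARD('p) - real S)))"
  shows "max_risk n (test_HS n s S u)
           (sparse_class s S \<sigma> :: (real^'p::{finite,linorder}^'p::{finite,linorder}) set)
         \<le> 4 * exp (- (u - 1) * ln (real (s * (S choose s))))"
proof -
  define L where "L = ln (real (s * (S choose s)))"
  define L' where "L' = ln (real (s * (2 * s + 1) * (S choose s)))"
  define N where "N = real n * (real CARD('p) - real S)"
  define z where "z = (u - 1) * L"
  define x where "x = sqrt (z / N)"
  have S: "2 * S < CARD('p)" using assms(4) by linarith
  have N: "N > 0" using S assms(1) by (simp add: N_def)
  have C: "s * (S choose s) \<ge> 1"
    using assms(2,3) by (simp add: Suc_le_eq zero_less_binomial)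
  then have L: "L \<ge> 0" unfolding L_def by (simp del: of_nat_mult)
  have "s * (S choose s) \<le> s * (2 * s + 1) * (S choose s)" by simp
  then have LL': "L \<le> L'"
    unfolding L_def L'_def using C by (subst ln_le_cancel_iff) (simp_all only: of_nat_le_iff of_nat_0_less_iff)
  have z: "z \<ge> 0" using L assms(5) by (simp add: z_def)
  \<comment> \<open>Serves twice: with \<open>u\<close> and \<open>L\<close> for the threshold, with
    \<open>u - 1\<close> and \<open>L'\<close> for the margin required of \<sigma>.\<close>
  have two_x: "2 * x \<le> sqrt (4 * w * l / N)" if "u - 1 \<le> w" "L \<le> l" for w l
  proof -
    have "2 * x = sqrt (4 * (z / N))" unfolding x_def real_sqrt_mult[of 4] by simp
    also have "\<dots> \<le> sqrt (4 * (w * l / N))"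
      using that N L assms(5) unfolding z_def
      by (intro real_sqrt_le_mono mult_left_mono divide_right_mono mult_mono) auto
    finally show ?thesis by (simp add: mult.assoc)
  qed
  have thr: "2 * real s * x \<le> threshold_HS n CARD('p) s S u"
  proof -
    have "real s * (2 * x) \<le> threshold_HS n CARD('p) s S u"
      unfolding threshold_HS_def L_def[symmetric] N_def[symmetric]
      using two_x[of u L] by (intro mult_left_mono) auto
    then show ?thesis by (simp add: mult_ac)
  qed
  have thr': "threshold_HS n CARD('p) s S u + 2 * x \<le> \<sigma>"
    using two_x[of "u - 1" L'] LL' assms(7) unfolding L'_def[symmetric] N_def[symmetric] by linarith
  have I: "\<P>(X in iid_gaussian n (mat 1 :: real^'p::{finite,linorder}^'p::{finite,linorder}). test_HS n s S u X = 1) \<le> 2 * exp (- z)"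
    using test_HS_type_I[OF assms(1-3) _ assms(5), where 'p='p] S by (simp add: z_def L_def)
  have II: "\<P>(X in iid_gaussian n \<Sigma>. test_HS n s S u X = 0) \<le> exp (- z)"
    if "\<Sigma> \<in> sparse_class s S \<sigma>" for \<Sigma> :: "real^'p::{finite,linorder}^'p::{finite,linorder}"
    by (rule test_HS_type_II[OF assms(1,2) S assms(6) z x_def[unfolded N_def] thr thr' that])
  \<comment> \<open>The empty class has risk 0 by convention; otherwise the supremum inherits the
    uniform bound.\<close>
  have "(if (sparse_class s S \<sigma> :: (real^'p::{finite,linorder}^'p::{finite,linorder}) set) = {} then 0
      else (SUP \<Sigma>\<in>(sparse_class s S \<sigma> :: (real^'p::{finite,linorder}^'p::{finite,linorder}) set). \<P>(X in iid_gaussian n \<Sigma>. test_HS n s S u X = 0))) \<le> exp (- z)"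
    using II by (auto intro!: cSUP_least)
  with I have "max_risk n (test_HS n s S u) (sparse_class s S \<sigma> :: (real^'p::{finite,linorder}^'p::{finite,linorder}) set) \<le> 3 * exp (- z)"
    unfolding max_risk_def by linarith
  also have "\<dots> \<le> 4 * exp (- z)" by simp
  finally show ?thesis by (simp only: z_def L_def minus_mult_left)
qed

end
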